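(* Let $k\ge2$, let $G$ be a connected $k$-uniform linear hypergraph, let $v$ be a vertex of $G$, and let $p,q$ be nonnegative integers. If both $p$ and $q$ are not zero, then $$\rho(\mathcal{A}(G(v;p,q)))> \rho(\mathcal{A}(G(v;p+q,0))),$$ $$\rho(\mathcal{Q}(G(v;p,q)))> \rho(\mathcal{Q}(G(v;p+q,0))),$$ $$\rho(\mathcal{Q}^{*}(G(v;p,q)))> \rho(\mathcal{Q}^{*}(G(v;p+q,0))).$$
   Context: Hypergraphs. A $k$-uniform hypergraph $G=(V,E)$ has finite vertex set $V$ (labelled as $[n]=\{1,\dots,n\}$) and a set $E$ of $k$-element subsets of $V$ (the edges; no repeated edges). The degree $d_i$ of a vertex $i$ is the number of edges containing $i$. $G$ is linear if any two distinct edges have at most one common vertex. A path is a sequence $w_1,f_1,w_2,\dots,w_q,f_q,w_{q+1}$ with distinct vertices $w_j$, distinct edges $f_j$, and $w_j,w_{j+1}\in f_j$ for all $j$; $G$ is connected if any two vertices are joined by a path. A path $P=(v_0,e_1,v_1,\dots,v_{p-1},e_p,v_p)$ in a $k$-uniform hypergraph $H$ is a pendent path starting from $v_0$ if $v_1,\dots,v_{p-1}$ have degree two, $v_p$ has degree one, and all $k-2$ vertices of $e_i\setminus\{v_{i-1},v_i\}$ have degree one in $H$, for $i=1,\dots,p$. $G(v;p,q)$ denotes the $k$-uniform linear hypergraph obtained from $G$ by adding two pendent paths $P=(v,e_1,v_1,\dots,v_{p-1},e_p,v_p)$ and $Q=(v,e_1',u_1,\dots,u_{q-1},e_q',u_q)$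 at $v$ (all vertices of the added edges other than $v$ being new), where $P$ and $Q$ share only the vertex $v$; a path of length $0$ means that nothing is added, so $G(v;p+q,0)$ is $G$ with one pendent path of length $p+q$ added at $v$. Tensors. For a real order-$k$ dimension-$n$ tensor $\mathcal{T}=(\mathcal{T}_{i_1\cdots i_k})$ and $x\in\mathbb{C}^n$, $\mathcal{T}x\in\mathbb{C}^n$ is defined by $(\mathcal{T}x)_i=\sum_{i_2,\dots,i_k=1}^n\mathcal{T}_{ii_2\cdots i_k}x_{i_2}\cdots x_{i_k}$. A number $\lambda\in\mathbb{C}$ is an eigenvalue of $\mathcal{T}$ with eigenvector $0\ne x\in\mathbb{C}^n$ if $(\mathcal{T}x)_i=\lambda x_i^{k-1}$ for all $i$. The spectral radius $\rho(\mathcal{T})$ is the maximum modulus of an eigenvalue of $\mathcal{T}$. For a $k$-uniform hypergraph $G$: the adjacency tensor $\mathcal{A}(G)$ has entries $a_{i_1\cdots i_k}=\frac1{(k-1)!}$ if $\{i_1,\dots,i_k\}\in E$ and $0$ otherwise; the signless Laplacian tensor is $\mathcal{Q}(G)=\mathcal{D}(G)+\mathcal{A}(G)$ where $\mathcal{D}(G)$ is the diagonal tensor with $\mathcal{D}_{i\cdots i}=d_i$; the incidence $Q$-tensor $\mathcal{Q}^*(G)$ has $(i_1,\dots,i_k)$-entry equal to the number of edges $e$ with $i_t\in e$ for all $t=1,\dots,k$ (indices may repeat).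
   Formalization: G is assumed to have at least one edge; for the one-vertex hypergraph without edges, G(v;p,q) and G(v;p+q,0) are the same loose path with p+q edges, so the strict inequalities fail. *)

theory Defs
  imports Complex_Main
begin

section \<open>Hypergraphs\<close>

record 'a hypergraph =
  verts :: "'a set"
  edges :: "'a set set"

definition uniform_hypergraph :: "nat \<Rightarrow> 'a hypergraph \<Rightarrow> bool" where
  "uniform_hypergraph k G \<longleftrightarrow>
     finite (verts G) \<and> (\<forall>e\<in>edges G. e \<subseteq> verts G \<and> card e = k)"

definition vertex_degree :: "'a hypergraph \<Rightarrow> 'a \<Rightarrow> nat" where
  "vertex_degree G i = card {e \<in> edges G. i \<in> e}"

definition linear_hypergraph :: "'a hypergraph \<Rightarrow> bool" where
  "linear_hypergraph G \<longleftrightarrow>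
     (\<forall>e\<in>edges G. \<forall>f\<in>edges G. e \<noteq> f \<longrightarrow> card (e \<inter> f) \<le> 1)"

definition hpath :: "'a hypergraph \<Rightarrow> 'a list \<Rightarrow> 'a set list \<Rightarrow> bool" where
  "hpath G ws fs \<longleftrightarrow>
     length ws = Suc (length fs) \<and>
     set ws \<subseteq> verts G \<and> set fs \<subseteq> edges G \<and> distinct ws \<and> distinct fs \<and>
     (\<forall>j<length fs. ws ! j \<in> fs ! j \<and> ws ! Suc j \<in> fs ! j)"

definition connected_hypergraph :: "'a hypergraph \<Rightarrow> bool" where
  "connected_hypergraph G \<longleftrightarrow>
     (\<forall>u\<in>verts G. \<forall>w\<in>verts G. \<exists>ws fs. hpath G ws fs \<and> hd ws = u \<and> last ws = w)"

definition pendent_path :: "'a hypergraph \<Rightarrow> 'a list \<Rightarrow> 'a set list \<Rightarrow> bool" where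
  "pendent_path H ws fs \<longleftrightarrow>
     hpath H ws fs \<and>
     (\<forall>i. 0 < i \<and> i < length fs \<longrightarrow> vertex_degree H (ws ! i) = 2) \<and>
     (fs \<noteq> [] \<longrightarrow> vertex_degree H (last ws) = 1) \<and>
     (\<forall>i<length fs. \<forall>u \<in> fs ! i - {ws ! i, ws ! Suc i}. vertex_degree H u = 1)"

section \<open>Attaching two pendent paths at a vertex\<close>

text \<open>
  The vertices of \<open>G\<close> become \<open>Old u\<close>.  The tag \<open>s\<close> distinguishes the two attached paths
  (\<open>True\<close> for \<open>P\<close>, \<open>False\<close> for \<open>Q\<close>), and \<open>New s i j\<close> with \<open>i \<ge> 1\<close> and \<open>j < k - 1\<close> are the
  \<open>k - 1\<close> vertices contributed by the \<open>i\<close>-th edge of path \<open>s\<close>; the one with \<open>j = 0\<close> is the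
  end vertex \<open>v\<^sub>i\<close> (resp. \<open>u\<^sub>i\<close>), to which the next edge is attached.
\<close>

datatype 'a ext_vertex = Old 'a | New bool nat nat

definition joint :: "'a \<Rightarrow> bool \<Rightarrow> nat \<Rightarrow> 'a ext_vertex" where
  "joint v s i = (if i = 0 then Old v else New s i 0)"

definition path_edge :: "nat \<Rightarrow> 'a \<Rightarrow> bool \<Rightarrow> nat \<Rightarrow> 'a ext_vertex set" where
  "path_edge k v s i = insert (joint v s (i - 1)) {New s i j |j. j < k - 1}"

definition attach_paths ::
  "nat \<Rightarrow> 'a hypergraph \<Rightarrow> 'a \<Rightarrow> nat \<Rightarrow> nat \<Rightarrow> 'a ext_vertex hypergraph" where
  "attach_paths k G v p q =
     \<lparr> verts = Old ` verts G
         \<union> {New True i j |i j. 1 \<le> i \<and> i \<le> p \<and> j < k - 1}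
         \<union> {New False i j |i j. 1 \<le> i \<and> i \<le> q \<and> j < k - 1},
       edges = (\<lambda>e. Old ` e) ` edges G
         \<union> path_edge k v True ` {1..p}
         \<union> path_edge k v False ` {1..q} \<rparr>"

text \<open>
  The explicit construction meets its intended description: it is a \<open>k\<close>-uniform linear
  hypergraph in which the two attached paths are pendent paths starting from \<open>v\<close>.
\<close>

lemma card_New: "card ({New s i j |j. j < k - 1} :: 'a ext_vertex set) = k - 1"
proof -
  have "({New s i j |j. j < k - 1} :: 'a ext_vertex set) = New s i ` {..<k - 1}" by auto
  thus ?thesis by (simp only:) (simp add: card_image inj_on_def)
qed

lemma attach_paths_uniform:
  assumes "k \<ge> 2" "uniform_hypergraph k G" "v \<in> verts G"
  shows "uniform_hypergraph k (attach_paths k G v p q)"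
proof -
  let ?H = "attach_paths k G v p q"
  have *: "{New s i j |i j. 1 \<le> i \<and> i \<le> m \<and> j < k - 1} = (\<lambda>(i, j). New s i j) ` ({1..m} \<times> {..<k - 1})"
    for s :: bool and m by auto
  have fin: "finite (verts ?H)"
    using assms(2) unfolding attach_paths_def * by (simp add: uniform_hypergraph_def)
  have cd: "card (path_edge k v s i) = k" if "i \<ge> 1" for s i
  proof -
    have "joint v s (i - 1) \<notin> {New s i j |j. j < k - 1}"
      using that by (auto simp: joint_def)
    moreover have "finite {New s i j |j. j < k - 1}" by simp
    ultimately show ?thesis using assms(1) by (simp add: path_edge_def card_New del: One_nat_def)
  qed
  have sub: "path_edge k v True i \<subseteq> verts ?H" if "1 \<le> i" "i \<le> p" for i
    using that assms by (auto simp: path_edge_def joint_def attach_paths_def)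
  have sub': "path_edge k v False i \<subseteq> verts ?H" if "1 \<le> i" "i \<le> q" for i
    using that assms by (auto simp: path_edge_def joint_def attach_paths_def)
  have old: "Old ` e \<subseteq> verts ?H \<and> card (Old ` e) = k" if "e \<in> edges G" for e
  proof -
    have "e \<subseteq> verts G" "card e = k"
      using that assms(2) by (auto simp: uniform_hypergraph_def)
    thus ?thesis by (simp add: attach_paths_def card_image inj_on_def image_mono le_supI1)
  qed
  have "e \<subseteq> verts ?H \<and> card e = k" if "e \<in> edges ?H" for e
  proof -
    from that consider e' where "e' \<in> edges G" "e = Old ` e'"
      | i where "1 \<le> i" "i \<le> p" "e = path_edge k v True i"
      | i where "1 \<le> i" "i \<le> q" "e = path_edge k v False i"
      unfolding attach_paths_def by auto
    thus ?thesis by cases (simp_all add: old sub sub' cd del: One_nat_def)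
  qed
  with fin show ?thesis unfolding uniform_hypergraph_def by blast
qed

lemma attach_paths_linear:
  assumes "uniform_hypergraph k G" "linear_hypergraph G"
  shows "linear_hypergraph (attach_paths k G v p q)"
proof -
  let ?H = "attach_paths k G v p q"
  have le: "card A \<le> 1" if "\<And>x y. x \<in> A \<Longrightarrow> y \<in> A \<Longrightarrow> x = y" for A :: "'a ext_vertex set"
  proof (cases "finite A")
    case True
    thus ?thesis using that by (simp add: card_le_Suc0_iff_eq)
  qed simp
  have ff: "card (path_edge k v s i \<inter> path_edge k v t j) \<le> 1"
    if "path_edge k v s i \<noteq> path_edge k v t j" "i \<ge> 1" "j \<ge> 1" for s t i j
  proof (rule le)
    fix x y assume "x \<in> path_edge k v s i \<inter> path_edge k v t j" "y \<in> path_edge k v s i \<inter> path_edge k v t j"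
    moreover have "s \<noteq> t \<or> i \<noteq> j" using that by blast
    ultimately show "x = y" using that(2,3)
      by (auto simp: path_edge_def joint_def split: if_splits)
  qed
  have of: "card (Old ` e \<inter> path_edge k v s i) \<le> 1" for e s i
    by (rule le) (auto simp: path_edge_def joint_def split: if_splits)
  have of': "card (path_edge k v s i \<inter> Old ` e) \<le> 1" for e s i
    using of by (simp only: Int_commute)
  have oo: "card (Old ` e \<inter> Old ` f) \<le> 1" if "e \<in> edges G" "f \<in> edges G" "e \<noteq> f" for e f
  proof -
    have "Old ` e \<inter> Old ` f = Old ` (e \<inter> f)" by auto
    thus ?thesis using that assms(2) by (simp add: linear_hypergraph_def card_image inj_on_def)
  qed
  have split: "(\<exists>e'\<in>edges G. e = Old ` e') \<or> (\<exists>s i. 1 \<le> i \<and> e = path_edge k v s i)"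
    if "e \<in> edges ?H" for e
  proof -
    from that consider e' where "e' \<in> edges G" "e = Old ` e'"
      | i where "1 \<le> i" "e = path_edge k v True i"
      | i where "1 \<le> i" "e = path_edge k v False i"
      unfolding attach_paths_def by auto
    thus ?thesis by cases blast+
  qed
  show ?thesis unfolding linear_hypergraph_def
  proof (intro ballI impI)
    fix e f assume "e \<in> edges ?H" "f \<in> edges ?H" and ne: "e \<noteq> f"
    from split[OF this(1)] show "card (e \<inter> f) \<le> 1"
    proof (elim disjE bexE exE conjE)
      fix e' assume e': "e' \<in> edges G" "e = Old ` e'"
      from split[OF \<open>f \<in> edges ?H\<close>] show ?thesis
        using e' ne oo of by blast
    next
      fix s i assume e: "1 \<le> i" "e = path_edge k v s i"
      from split[OF \<open>f \<in> edges ?H\<close>] show ?thesis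
        using e ne ff of' by blast
    qed
  qed
qed

lemma attach_paths_pendent:
  assumes "k \<ge> 2" "uniform_hypergraph k G" "v \<in> verts G"
  shows "pendent_path (attach_paths k G v p q)
           (map (joint v True) [0..<Suc p]) (map (path_edge k v True) [1..<Suc p])"
    and "pendent_path (attach_paths k G v p q)
           (map (joint v False) [0..<Suc q]) (map (path_edge k v False) [1..<Suc q])"
proof -
  let ?H = "attach_paths k G v p q"
  have edges: "edges ?H = (\<lambda>e. Old ` e) ` edges G \<union>
      {path_edge k v t l |t l. 1 \<le> l \<and> l \<le> (if t then p else q)}"
  proof -
    have "{path_edge k v t l |t l. 1 \<le> l \<and> l \<le> (if t then p else q)} =
        path_edge k v True ` {1..p} \<union> path_edge k v False ` {1..q}"
      unfolding set_eq_iff Un_iff image_iff mem_Collect_eq ex_bool_eq Bex_def atLeastAtMost_iff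
      by simp blast
    thus ?thesis by (simp add: attach_paths_def Un_assoc)
  qed
  have verts: "verts ?H = Old ` verts G \<union>
      {New t l j |t l j. 1 \<le> l \<and> l \<le> (if t then p else q) \<and> j < k - 1}"
  proof -
    have "({New t l j |t l j. 1 \<le> l \<and> l \<le> (if t then p else q) \<and> j < k - 1} :: 'a ext_vertex set) =
        {New True i j |i j. 1 \<le> i \<and> i \<le> p \<and> j < k - 1}
        \<union> {New False i j |i j. 1 \<le> i \<and> i \<le> q \<and> j < k - 1}"
      unfolding set_eq_iff Un_iff mem_Collect_eq ex_bool_eq by simp
    thus ?thesis by (simp add: attach_paths_def Un_assoc)
  qed
  have mem: "New s i j \<in> path_edge k v t l \<longleftrightarrow>
      s = t \<and> (l = i \<and> j < k - 1 \<or> l = Suc i \<and> i > 0 \<and> j = 0)" if "l \<ge> 1" for s t i j l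
    using that by (auto simp: path_edge_def joint_def)
  have inj: "s = t \<and> i = l" if "path_edge k v s i = path_edge k v t l" "i \<ge> 1" "l \<ge> 1" for s t i l
  proof -
    have "New s i 0 \<in> path_edge k v s i" "New t l 0 \<in> path_edge k v t l"
      using assms(1) by (auto simp: path_edge_def)
    hence "New s i 0 \<in> path_edge k v t l" "New t l 0 \<in> path_edge k v s i"
      using that(1) by auto
    hence "s = t \<and> (l = i \<or> l = Suc i)" "t = s \<and> (i = l \<or> i = Suc l)"
      unfolding mem[OF that(3)] mem[OF that(2)] by blast+
    thus ?thesis by auto
  qed
  have pend: "pendent_path ?H (map (joint v s) [0..<Suc m]) (map (path_edge k v s) [1..<Suc m])"
    if m: "m = (if s then p else q)" for s m
  proof -
    have deg: "{e \<in> edges ?H. New s i j \<in> e} =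
        (if i = m \<or> j \<noteq> 0 then {path_edge k v s i} else {path_edge k v s i, path_edge k v s (Suc i)})"
      if "1 \<le> i" "i \<le> m" "j < k - 1" for i j
    proof -
      have sel: "(1 \<le> l \<and> l \<le> (if t then p else q) \<and> New s i j \<in> path_edge k v t l) \<longleftrightarrow>
          t = s \<and> 1 \<le> l \<and> l \<le> m \<and> (l = i \<or> l = Suc i \<and> j = 0)" for t l
        using mem[of l s i j t] that m by (cases "1 \<le> l") auto
      have "{e \<in> edges ?H. New s i j \<in> e} =
          {path_edge k v t l |t l. 1 \<le> l \<and> l \<le> (if t then p else q) \<and> New s i j \<in> path_edge k v t l}"
        unfolding edges by auto
      also have "\<dots> = {path_edge k v s l |l. 1 \<le> l \<and> l \<le> m \<and> (l = i \<or> l = Suc i \<and> j = 0)}"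
        unfolding sel by blast
      also have "\<dots> = (if i = m \<or> j \<noteq> 0 then {path_edge k v s i}
          else {path_edge k v s i, path_edge k v s (Suc i)})"
        using that by auto
      finally show ?thesis .
    qed
    have one: "vertex_degree ?H (New s i j) = 1" if "1 \<le> i" "i \<le> m" "j < k - 1" "i = m \<or> j \<noteq> 0" for i j
      using deg[of i j] that by (simp add: vertex_degree_def)
    have two: "vertex_degree ?H (New s i 0) = 2" if "1 \<le> i" "i < m" for i
    proof -
      have "path_edge k v s i \<noteq> path_edge k v s (Suc i)"
        using inj[of s i s "Suc i"] that by linarith
      moreover have "{e \<in> edges ?H. New s i 0 \<in> e} = {path_edge k v s i, path_edge k v s (Suc i)}"
        using deg[of i 0] that assms(1) by simp
      ultimately show ?thesis unfolding vertex_degree_def by simp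
    qed
    have path: "hpath ?H (map (joint v s) [0..<Suc m]) (map (path_edge k v s) [1..<Suc m])"
      unfolding hpath_def
    proof (intro conjI)
      show "set (map (joint v s) [0..<Suc m]) \<subseteq> verts ?H"
      proof -
        have "joint v s i \<in> verts ?H" if "i \<le> m" for i
        proof (cases "i = 0")
          case True
          thus ?thesis using assms(3) by (simp add: verts joint_def)
        next
          case False
          hence "1 \<le> i" "i \<le> (if s then p else q)" "0 < k - 1"
            using that m assms(1) by auto
          thus ?thesis using False unfolding verts joint_def by auto
        qed
        thus ?thesis by auto
      qed
      show "set (map (path_edge k v s) [1..<Suc m]) \<subseteq> edges ?H"
      proof -
        have "path_edge k v s i \<in> edges ?H" if "1 \<le> i" "i \<le> m" for i
          using that unfolding edges m by blast
        thus ?thesis by auto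
      qed
      show "distinct (map (joint v s) [0..<Suc m])"
        unfolding distinct_map by (auto simp: inj_on_def joint_def split: if_splits)
      show "distinct (map (path_edge k v s) [1..<Suc m])"
        unfolding distinct_map using inj by (simp add: inj_on_def del: upt_Suc)
      show "\<forall>j<length (map (path_edge k v s) [1..<Suc m]).
          map (joint v s) [0..<Suc m] ! j \<in> map (path_edge k v s) [1..<Suc m] ! j \<and>
          map (joint v s) [0..<Suc m] ! Suc j \<in> map (path_edge k v s) [1..<Suc m] ! j"
        using assms(1) by (auto simp: path_edge_def joint_def simp del: upt_Suc)
    qed simp
    show ?thesis unfolding pendent_path_def
    proof (intro conjI allI impI ballI path)
      fix i assume "0 < i \<and> i < length (map (path_edge k v s) [1..<Suc m])"
      thus "vertex_degree ?H (map (joint v s) [0..<Suc m] ! i) = 2"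
        using two[of i] by (simp add: joint_def del: upt_Suc)
    next
      assume "map (path_edge k v s) [1..<Suc m] \<noteq> []"
      thus "vertex_degree ?H (last (map (joint v s) [0..<Suc m])) = 1"
        using one[of m 0] assms(1) by (simp add: joint_def split: if_splits)
    next
      fix i u assume "i < length (map (path_edge k v s) [1..<Suc m])"
        and "u \<in> map (path_edge k v s) [1..<Suc m] ! i -
              {map (joint v s) [0..<Suc m] ! i, map (joint v s) [0..<Suc m] ! Suc i}"
      hence "i < m" "u \<in> path_edge k v s (Suc i) - {joint v s i, joint v s (Suc i)}"
        by (auto simp del: upt_Suc)
      then obtain j where "i < m" "u = New s (Suc i) j" "j < k - 1" "j \<noteq> 0"
        by (auto simp: path_edge_def joint_def)
      thus "vertex_degree ?H u = 1" using one[of "Suc i" j] by simp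
    qed
  qed
  show "pendent_path ?H (map (joint v True) [0..<Suc p]) (map (path_edge k v True) [1..<Suc p])"
    using pend[of p True] by simp
  show "pendent_path ?H (map (joint v False) [0..<Suc q]) (map (path_edge k v False) [1..<Suc q])"
    using pend[of q False] by simp
qed

section \<open>Tensors\<close>

text \<open>
  A tensor of order \<open>k\<close> is a function on index lists, of which only the lists of length \<open>k\<close>
  over a finite index set \<open>I\<close> matter.  Here \<open>I\<close> is the vertex set itself, in place of
  \<open>{1, \<dots>, n}\<close>.
\<close>

type_synonym 'a tensor = "'a list \<Rightarrow> real"

definition tensor_apply ::
  "nat \<Rightarrow> 'a set \<Rightarrow> 'a tensor \<Rightarrow> ('a \<Rightarrow> complex) \<Rightarrow> 'a \<Rightarrow> complex" where
  "tensor_apply k I T x i =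
     (\<Sum>js | set js \<subseteq> I \<and> length js = k - 1. complex_of_real (T (i # js)) * (\<Prod>j\<leftarrow>js. x j))"

definition tensor_eigenvector ::
  "nat \<Rightarrow> 'a set \<Rightarrow> 'a tensor \<Rightarrow> complex \<Rightarrow> ('a \<Rightarrow> complex) \<Rightarrow> bool" where
  "tensor_eigenvector k I T l x \<longleftrightarrow>
     (\<exists>i\<in>I. x i \<noteq> 0) \<and> (\<forall>i\<in>I. tensor_apply k I T x i = l * x i ^ (k - 1))"

definition tensor_eigenvalue :: "nat \<Rightarrow> 'a set \<Rightarrow> 'a tensor \<Rightarrow> complex \<Rightarrow> bool" where
  "tensor_eigenvalue k I T l \<longleftrightarrow> (\<exists>x. tensor_eigenvector k I T l x)"

definition tensor_spectral_radius :: "nat \<Rightarrow> 'a set \<Rightarrow> 'a tensor \<Rightarrow> real" where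
  "tensor_spectral_radius k I T = (GREATEST r. \<exists>l. tensor_eigenvalue k I T l \<and> r = cmod l)"

definition adjacency_tensor :: "nat \<Rightarrow> 'a hypergraph \<Rightarrow> 'a tensor" where
  "adjacency_tensor k G is = (if set is \<in> edges G then 1 / fact (k - 1) else 0)"

definition degree_tensor :: "nat \<Rightarrow> 'a hypergraph \<Rightarrow> 'a tensor" where
  "degree_tensor k G is = (if is = replicate k (hd is) then real (vertex_degree G (hd is)) else 0)"

definition signless_laplacian_tensor :: "nat \<Rightarrow> 'a hypergraph \<Rightarrow> 'a tensor" where
  "signless_laplacian_tensor k G is = degree_tensor k G is + adjacency_tensor k G is"

definition incidence_Q_tensor :: "'a hypergraph \<Rightarrow> 'a tensor" where
  "incidence_Q_tensor G is = real (card {e \<in> edges G. set is \<subseteq> e})"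

definition rho_A :: "nat \<Rightarrow> 'a hypergraph \<Rightarrow> real" where
  "rho_A k G = tensor_spectral_radius k (verts G) (adjacency_tensor k G)"

definition rho_Q :: "nat \<Rightarrow> 'a hypergraph \<Rightarrow> real" where
  "rho_Q k G = tensor_spectral_radius k (verts G) (signless_laplacian_tensor k G)"

definition rho_Qstar :: "nat \<Rightarrow> 'a hypergraph \<Rightarrow> real" where
  "rho_Qstar k G = tensor_spectral_radius k (verts G) (incidence_Q_tensor G)"

end

theory Submission
  imports Defs "HOL-Analysis.Function_Topology" "HOL-Combinatorics.Multiset_Permutations"
begin

text \<open>
  All three tensors are gradients (up to the factor \<open>k\<close>) of a form \<open>F x = (\<Sum>e. phi e x)\<close>,
  where \<open>phi e x\<close> is a nonnegative combination of \<open>\<Sum>i\<in>e. x i ^ k\<close>, \<open>k * (\<Prod>i\<in>e. x i)\<close> and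
  \<open>(\<Sum>i\<in>e. x i) ^ k\<close>.  The weights are \<open>(0, 1, 0)\<close> for the adjacency tensor, \<open>(1, 1, 0)\<close> for the
  signless Laplacian and \<open>(0, 0, 1)\<close> for the incidence \<open>Q\<close>-tensor, so one argument serves for all.

  The spectral radius is the maximum of \<open>F\<close> over nonnegative \<open>x\<close> with \<open>(\<Sum>i. x i ^ k) = 1\<close>:
  a maximiser satisfies the eigenvalue equations, and by Euler's identity \<open>F\<close> at the moduli of any
  complex eigenvector bounds the modulus of its eigenvalue (\<open>tensor_spectral_radius_eq_radius\<close>).
  On a connected hypergraph a maximiser \<open>x\<close> is positive (\<open>maximiser_pos\<close>), and then moving a
  nonempty set of edges from a vertex \<open>r\<close> to a vertex \<open>w\<close> with \<open>x r \<le> x w\<close> strictly increases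
  the radius: the form at \<open>x\<close> does not decrease, and \<open>x\<close> cannot solve the eigenvalue equation
  at \<open>w\<close> both before and after the move (\<open>radius_less_move_edges\<close>).

  Take a maximiser \<open>x\<close> of \<open>G(v; p + q, 0)\<close>, and let \<open>u\<close> be the end vertex of the \<open>p\<close>-th edge of
  its path.  If \<open>x u \<le> x v\<close>, move the next path edge from \<open>u\<close> to \<open>v\<close>; otherwise move all the edges of
  \<open>G\<close> at \<open>v\<close> to \<open>u\<close>.  Both moves yield a hypergraph isomorphic to \<open>G(v; p, q)\<close>; in the second
  one the first \<open>p\<close> edges of the path are traversed backwards.
\<close>

section \<open>Uniform hypergraphs\<close>

lemma uniformD:
  assumes "uniform_hypergraph k H"
  shows "finite (verts H)" "finite (edges H)"
    and "\<And>e. e \<in> edges H \<Longrightarrow> e \<subseteq> verts H"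
    and "\<And>e. e \<in> edges H \<Longrightarrow> card e = k"
    and "\<And>e. e \<in> edges H \<Longrightarrow> finite e"
proof -
  show *: "finite (verts H)" and "\<And>e. e \<in> edges H \<Longrightarrow> e \<subseteq> verts H" "\<And>e. e \<in> edges H \<Longrightarrow> card e = k"
    using assms by (auto simp: uniform_hypergraph_def)
  hence "edges H \<subseteq> Pow (verts H)" by auto
  thus "finite (edges H)" using * finite_subset by blast
  show "\<And>e. e \<in> edges H \<Longrightarrow> finite e"
    using assms finite_subset unfolding uniform_hypergraph_def by metis
qed

text \<open>
  Connectedness in terms of cuts: no nonempty proper set of vertices is closed under the edges.
\<close>

definition indecomposable :: "'v hypergraph \<Rightarrow> bool" where
  "indecomposable H \<longleftrightarrow> (\<forall>S\<subseteq>verts H. S \<noteq> {} \<longrightarrow>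
     (\<forall>e\<in>edges H. e \<inter> S \<noteq> {} \<longrightarrow> e \<subseteq> S) \<longrightarrow> S = verts H)"

text \<open>
  The edge \<open>e\<close> with its vertex \<open>r\<close> replaced by \<open>w\<close>; meant for \<open>r \<in> e\<close> and \<open>w \<notin> e\<close>.
\<close>

definition swap_vertex :: "'v \<Rightarrow> 'v \<Rightarrow> 'v set \<Rightarrow> 'v set" where
  "swap_vertex r w e = insert w (e - {r})"

text \<open>
  The hypergraph obtained by moving the edges in \<open>M\<close> from \<open>r\<close> to \<open>w\<close>.
\<close>

definition move_edges :: "'v \<Rightarrow> 'v \<Rightarrow> 'v set set \<Rightarrow> 'v hypergraph \<Rightarrow> 'v hypergraph" where
  "move_edges r w M H =
     \<lparr>verts = verts H, edges = (edges H - M) \<union> swap_vertex r w ` M\<rparr>"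

lemma move_edges_uniform:
  assumes H: "uniform_hypergraph k H" and w: "w \<in> verts H"
    and M: "M \<subseteq> edges H" "\<And>e. e \<in> M \<Longrightarrow> r \<in> e \<and> w \<notin> e"
  shows "uniform_hypergraph k (move_edges r w M H)"
  unfolding uniform_hypergraph_def
proof (intro conjI ballI)
  note u = uniformD[OF H]
  show "finite (verts (move_edges r w M H))" using u(1) by (simp add: move_edges_def)
  fix e assume "e \<in> edges (move_edges r w M H)"
  then consider "e \<in> edges H" | e' where "e' \<in> M" "e = swap_vertex r w e'"
    by (auto simp: move_edges_def)
  hence "e \<subseteq> verts H \<and> card e = k"
  proof cases
    case 1
    thus ?thesis using u by auto
  next
    case 2
    hence "e' \<in> edges H" "finite e'" "r \<in> e'" "w \<notin> e'" using M u(5) by auto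
    moreover from this have "card e' \<noteq> 0" by auto
    ultimately show ?thesis
      using 2 w u(3,4)[of e'] by (auto simp: swap_vertex_def)
  qed
  thus "e \<subseteq> verts (move_edges r w M H)" "card e = k" by (auto simp: move_edges_def)
qed

section \<open>Edge forms and their gradients\<close>

text \<open>
  The weights \<open>a\<close>, \<open>b\<close>, \<open>c\<close> of the power sum, the product and the power of the sum.
  With \<open>b + c = 0\<close> the form would not couple the vertices of an edge.
\<close>

locale edge_form =
  fixes k :: nat and a b c :: real
  assumes k_ge2: "2 \<le> k" and nonneg: "0 \<le> a" "0 \<le> b" "0 \<le> c" and bc_pos: "0 < b + c"
begin

text \<open>
  The contribution of an edge to the form; \<open>psi e i\<close> below is \<open>1 / k\<close> times the partial derivative
  of \<open>phi e\<close> at the vertex \<open>i \<in> e\<close>.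
\<close>

definition phi :: "'v set \<Rightarrow> ('v \<Rightarrow> real) \<Rightarrow> real" where
  "phi e x = a * (\<Sum>i\<in>e. x i ^ k) + b * (real k * (\<Prod>i\<in>e. x i)) + c * (\<Sum>i\<in>e. x i) ^ k"

text \<open>
  The scalars are left polymorphic because complex eigenvectors are compared with real ones.
\<close>

definition psi :: "'v set \<Rightarrow> 'v \<Rightarrow> ('v \<Rightarrow> 'f::real_normed_field) \<Rightarrow> 'f" where
  "psi e i x = of_real a * x i ^ (k - 1) + of_real b * (\<Prod>j\<in>e - {i}. x j)
     + of_real c * (\<Sum>j\<in>e. x j) ^ (k - 1)"

lemma power_k: "(t::'f::monoid_mult) ^ k = t * t ^ (k - 1)"
  using k_ge2 by (cases k) auto

lemma phi_update:
  assumes "finite e" "i \<in> e"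
  shows "phi e (x(i := t)) = a * (t ^ k + (\<Sum>j\<in>e - {i}. x j ^ k))
     + b * (real k * (t * (\<Prod>j\<in>e - {i}. x j))) + c * (t + (\<Sum>j\<in>e - {i}. x j)) ^ k"
  unfolding phi_def using assms by (simp add: sum.remove[of e i] prod.remove[of e i])

lemma phi_deriv:
  assumes "finite e" "i \<in> e"
  shows "((\<lambda>t. phi e (x(i := t))) has_real_derivative real k * psi e i x) (at (x i))"
proof -
  have "(\<Sum>j\<in>e. x j) = x i + (\<Sum>j\<in>e - {i}. x j)"
    using assms by (simp add: sum.remove)
  thus ?thesis unfolding phi_update[OF assms] psi_def
    by (auto intro!: derivative_eq_intros simp: algebra_simps)
qed

lemma phi_cong: "(\<And>i. i \<in> e \<Longrightarrow> x i = y i) \<Longrightarrow> phi e x = phi e y"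
  unfolding phi_def by simp

lemma phi_image: "inj_on f e \<Longrightarrow> phi (f ` e) x = phi e (x \<circ> f)"
  unfolding phi_def by (simp add: sum.reindex prod.reindex)

lemma phi_mono:
  assumes "\<And>i. i \<in> e \<Longrightarrow> 0 \<le> x i" "\<And>i. i \<in> e \<Longrightarrow> x i \<le> y i"
  shows "phi e x \<le> phi e y"
  unfolding phi_def using assms nonneg
  by (intro add_mono mult_left_mono sum_mono prod_mono power_mono sum_nonneg) auto

lemma phi_scale: "card e = k \<Longrightarrow> phi e (\<lambda>i. t * x i) = t ^ k * phi e x"
  unfolding phi_def
  by (simp add: power_mult_distrib prod.distrib flip: sum_distrib_left) (simp add: algebra_simps)

text \<open>Euler's identity for homogeneous polynomials, with the factor \<open>k\<close> absorbed in \<open>psi\<close>.\<close>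

lemma phi_euler:
  fixes x :: "'v \<Rightarrow> real"
  assumes "finite e" "card e = k"
  shows "(\<Sum>i\<in>e. x i * psi e i x) = phi e x"
proof -
  have "(\<Sum>i\<in>e. x i * psi e i x) =
      (\<Sum>i\<in>e. a * x i ^ k + b * (\<Prod>j\<in>e. x j) + c * (x i * (\<Sum>j\<in>e. x j) ^ (k - 1)))"
    unfolding psi_def power_k
    by (intro sum.cong refl) (simp add: algebra_simps prod.remove[OF assms(1)])
  also have "\<dots> = phi e x"
    unfolding phi_def power_k[of "sum x e"] using assms
    by (simp add: sum.distrib sum_distrib_left sum_distrib_right algebra_simps)
  finally show ?thesis .
qed

lemma psi_nonneg:
  fixes x :: "'v \<Rightarrow> real"
  assumes "\<And>j. j \<in> e \<Longrightarrow> 0 \<le> x j" "i \<in> e"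
  shows "0 \<le> psi e i x"
  unfolding psi_def using assms nonneg
  by (intro add_nonneg_nonneg mult_nonneg_nonneg prod_nonneg zero_le_power sum_nonneg) auto

lemma psi_pos:
  fixes x :: "'v \<Rightarrow> real"
  assumes "finite e" "\<And>j. j \<in> e \<Longrightarrow> 0 < x j" "i \<in> e"
  shows "0 < psi e i x"
proof -
  have 1: "0 < (\<Prod>j\<in>e - {i}. x j)" using assms by (intro prod_pos) auto
  have 2: "0 < (\<Sum>j\<in>e. x j) ^ (k - 1)" using assms by (intro zero_less_power sum_pos) auto
  have "0 < b * (\<Prod>j\<in>e - {i}. x j) + c * (\<Sum>j\<in>e. x j) ^ (k - 1)"
  proof (cases "b = 0")
    case True
    thus ?thesis using bc_pos 2 by simp
  next
    case False
    thus ?thesis using nonneg 1 2 by (intro add_pos_nonneg mult_pos_pos mult_nonneg_nonneg) auto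
  qed
  moreover have "0 \<le> a * x i ^ (k - 1)" using assms(2,3) nonneg by (simp add: less_imp_le)
  ultimately show ?thesis unfolding psi_def by simp
qed

lemma norm_psi_le:
  fixes x :: "'v \<Rightarrow> 'f::real_normed_field"
  shows "norm (psi e i x) \<le> psi e i (\<lambda>j. norm (x j))"
proof -
  have "norm (\<Sum>j\<in>e. x j) ^ (k - 1) \<le> (\<Sum>j\<in>e. norm (x j)) ^ (k - 1)"
    by (intro power_mono norm_sum) simp
  hence "c * norm (\<Sum>j\<in>e. x j) ^ (k - 1) \<le> c * (\<Sum>j\<in>e. norm (x j)) ^ (k - 1)"
    using nonneg by (intro mult_left_mono)
  thus ?thesis unfolding psi_def using nonneg
    by (intro order.trans[OF norm_triangle_ineq] add_mono)
       (auto simp: norm_mult norm_power prod_norm)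
qed

lemma psi_of_real:
  "psi e i (\<lambda>j. of_real (x j)) = (of_real (psi e i x) :: 'f::real_normed_field)"
  unfolding psi_def by simp

section \<open>The maximum of the form on the nonnegative unit sphere\<close>

definition form :: "'v hypergraph \<Rightarrow> ('v \<Rightarrow> real) \<Rightarrow> real" where
  "form H x = (\<Sum>e\<in>edges H. phi e x)"

text \<open>
  The nonnegative part of the unit sphere of the \<open>k\<close>-norm.  Values outside \<open>V\<close> are irrelevant.
\<close>

definition nonneg_sphere :: "'v set \<Rightarrow> ('v \<Rightarrow> real) set" where
  "nonneg_sphere V = {x. (\<forall>i\<in>V. 0 \<le> x i) \<and> (\<Sum>i\<in>V. x i ^ k) = 1}"

text \<open>
  The maximum of the form on the nonnegative sphere; it is attained (\<open>maximiser_exists\<close>) as soon as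
  there is a vertex.
\<close>

definition radius :: "'v hypergraph \<Rightarrow> real" where
  "radius H = Sup (form H ` nonneg_sphere (verts H))"

text \<open>
  A nonnegative unit vector at which the form is maximal.
\<close>

definition maximiser :: "'v hypergraph \<Rightarrow> ('v \<Rightarrow> real) \<Rightarrow> bool" where
  "maximiser H x \<longleftrightarrow> x \<in> nonneg_sphere (verts H) \<and> form H x = radius H"

text \<open>
  Component \<open>i\<close> of the gradient of the form, divided by \<open>k\<close>.
\<close>

definition gradient :: "'v hypergraph \<Rightarrow> 'v \<Rightarrow> ('v \<Rightarrow> 'f::real_normed_field) \<Rightarrow> 'f" where
  "gradient H i x = (\<Sum>e | e \<in> edges H \<and> i \<in> e. psi e i x)"

lemma form_euler:
  fixes x :: "'v \<Rightarrow> real"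
  assumes "uniform_hypergraph k H"
  shows "(\<Sum>i\<in>verts H. x i * gradient H i x) = form H x"
proof -
  note u = uniformD[OF assms]
  have "(\<Sum>i\<in>verts H. x i * gradient H i x)
      = (\<Sum>i\<in>verts H. \<Sum>e | e \<in> edges H \<and> i \<in> e. x i * psi e i x)"
    by (simp add: gradient_def sum_distrib_left)
  also have "\<dots> = (\<Sum>e\<in>edges H. \<Sum>i | i \<in> verts H \<and> i \<in> e. x i * psi e i x)"
    by (rule sum.swap_restrict) (use u in auto)
  also have "\<dots> = form H x" unfolding form_def
  proof (rule sum.cong[OF refl])
    fix e assume e: "e \<in> edges H"
    hence "{i. i \<in> verts H \<and> i \<in> e} = e" using u(3) by auto
    thus "(\<Sum>i | i \<in> verts H \<and> i \<in> e. x i * psi e i x) = phi e x"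
      using phi_euler[OF u(5)[OF e] u(4)[OF e]] by simp
  qed
  finally show ?thesis .
qed

lemma maximum_attained:
  fixes H :: "'v hypergraph"
  assumes H: "uniform_hypergraph k H" and ne: "verts H \<noteq> {}"
  shows "\<exists>x\<in>nonneg_sphere (verts H). \<forall>y\<in>nonneg_sphere (verts H). form H y \<le> form H x"
proof -
  let ?V = "verts H"
  note u = uniformD[OF H]
  \<comment> \<open>Coordinates outside the vertex set are set to 0, so that Tychonoff gives a compact box.\<close>
  define B :: "('v \<Rightarrow> real) set" where "B = PiE UNIV (\<lambda>i. if i \<in> ?V then {0..1} else {0})"
  define T where "T = {x :: 'v \<Rightarrow> real. (\<Sum>i\<in>?V. x i ^ k) = 1}"
  have "compactin (product_topology (\<lambda>i. euclidean) UNIV) B"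
    unfolding B_def compactin_PiE by auto
  hence B: "compact B" by (simp add: euclidean_product_topology)
  have coord: "continuous_on UNIV (\<lambda>x :: 'v \<Rightarrow> real. x i)" for i by simp
  have "closed T" unfolding T_def
    by (intro closed_Collect_eq continuous_on_sum continuous_on_power coord continuous_intros)
  hence comp: "compact (B \<inter> T)" using B by blast
  have cont: "continuous_on (B \<inter> T) (form H)"
    unfolding form_def phi_def
    by (rule continuous_on_subset[of UNIV])
       (intro continuous_on_sum continuous_on_prod continuous_on_power coord continuous_on_add
         continuous_on_mult continuous_on_const, simp)
  obtain v where v: "v \<in> ?V" using ne by blast
  have "(\<lambda>i. if i = v then 1 else 0) \<in> B \<inter> T"
    using v u(1) k_ge2
    by (auto simp: B_def T_def zero_power if_distrib[of "\<lambda>t. t ^ k"] cong: if_cong)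
  then obtain x where x: "x \<in> B \<inter> T" and max: "\<And>y. y \<in> B \<inter> T \<Longrightarrow> form H y \<le> form H x"
    using continuous_attains_sup[OF comp _ cont] by blast
  have "x \<in> nonneg_sphere ?V"
    using x by (force simp: B_def T_def nonneg_sphere_def PiE_def Pi_def split: if_splits)
  moreover have "form H y \<le> form H x" if y: "y \<in> nonneg_sphere ?V" for y
  proof -
    define z where "z = (\<lambda>i. if i \<in> ?V then y i else 0)"
    have "y i \<le> 1" if "i \<in> ?V" for i
    proof -
      have "y i ^ k \<le> (\<Sum>i\<in>?V. y i ^ k)"
        using y that u(1) by (intro member_le_sum) (auto simp: nonneg_sphere_def)
      hence "y i ^ k \<le> 1 ^ k" using y by (simp add: nonneg_sphere_def)
      thus ?thesis using k_ge2 power_le_imp_le_base[of "y i" "k - 1" 1] by simp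
    qed
    hence "z \<in> B \<inter> T"
      using y by (auto simp: z_def B_def T_def nonneg_sphere_def)
    moreover have "form H z = form H y" unfolding form_def
      by (intro sum.cong refl phi_cong) (use u(3) in \<open>auto simp: z_def\<close>)
    ultimately show ?thesis using max by metis
  qed
  ultimately show ?thesis by blast
qed

lemma maximiser_exists:
  assumes "uniform_hypergraph k H" "verts H \<noteq> {}"
  shows "\<exists>x. maximiser H x"
proof -
  obtain x where "x \<in> nonneg_sphere (verts H)" "\<forall>y\<in>nonneg_sphere (verts H). form H y \<le> form H x"
    using maximum_attained[OF assms] by blast
  moreover from this have "radius H = form H x"
    unfolding radius_def by (intro cSup_eq_maximum) auto
  ultimately show ?thesis unfolding maximiser_def by auto
qed

lemma form_le_radius:
  assumes H: "uniform_hypergraph k H" and x: "\<And>i. i \<in> verts H \<Longrightarrow> 0 \<le> x i"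
  shows "form H x \<le> radius H * (\<Sum>i\<in>verts H. x i ^ k)"
proof (cases "(\<Sum>i\<in>verts H. x i ^ k) = 0")
  case True
  note u = uniformD[OF H]
  have z: "x i = 0" if "i \<in> verts H" for i
    using True that u(1) x k_ge2 by (simp add: sum_nonneg_eq_0_iff)
  have "form H x = (\<Sum>i\<in>verts H. x i * gradient H i x)"
    using form_euler[OF H] by simp
  also have "\<dots> = 0" using z by simp
  finally show ?thesis using True by simp
next
  case False
  note u = uniformD[OF H]
  let ?S = "\<Sum>i\<in>verts H. x i ^ k"
  have S: "0 < ?S" using False x by (simp add: order_less_le sum_nonneg)
  define r where "r = root k ?S"
  have r: "0 < r" "r ^ k = ?S"
    using S k_ge2 by (auto simp: r_def real_root_pow_pos2)
  define y where "y = (\<lambda>i. (1 / r) * x i)"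
  have y: "y \<in> nonneg_sphere (verts H)"
    unfolding nonneg_sphere_def y_def using x r S
    by (simp add: power_mult_distrib power_divide flip: sum_divide_distrib)
  have "form H y \<le> radius H"
    unfolding radius_def
  proof (rule cSup_upper)
    show "form H y \<in> form H ` nonneg_sphere (verts H)" using y by blast
    have "verts H \<noteq> {}" using False by auto
    thus "bdd_above (form H ` nonneg_sphere (verts H))"
      using maximum_attained[OF H] by (auto simp: bdd_above_def)
  qed
  moreover have "form H y = (1 / r) ^ k * form H x"
    unfolding form_def y_def sum_distrib_left by (intro sum.cong refl phi_scale u)
  ultimately show ?thesis using r S by (simp add: power_divide field_simps)
qed

text \<open>
  The first-order condition.  At a vertex where \<open>x\<close> vanishes, maximality only gives that the
  gradient is at most zero; equality holds there because the gradient is nonnegative.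
\<close>

lemma maximiser_eigen_equation:
  assumes H: "uniform_hypergraph k H" and x: "maximiser H x" and i: "i \<in> verts H"
  shows "gradient H i x = radius H * x i ^ (k - 1)"
proof -
  note u = uniformD[OF H]
  let ?V = "verts H" and ?R = "radius H"
  have x0: "\<And>j. j \<in> ?V \<Longrightarrow> 0 \<le> x j" and x1: "(\<Sum>j\<in>?V. x j ^ k) = 1" and xF: "form H x = ?R"
    using x by (auto simp: maximiser_def nonneg_sphere_def)
  define g where "g = (\<lambda>t. form H (x(i := t)) - ?R * (\<Sum>j\<in>?V. (x(i := t)) j ^ k))"
  have g0: "g (x i) = 0" using x1 by (simp add: g_def xF del: fun_upd_apply)
  have gle: "g t \<le> 0" if "0 \<le> t" for t
    using form_le_radius[OF H, of "x(i := t)"] x0 that by (simp add: g_def)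
  have d1: "((\<lambda>t. phi e (x(i := t))) has_real_derivative (if i \<in> e then real k * psi e i x else 0)) (at (x i))"
    if "e \<in> edges H" for e
  proof (cases "i \<in> e")
    case True
    thus ?thesis using phi_deriv u(5)[OF that] by simp
  next
    case False
    hence "phi e (x(i := t)) = phi e x" for t by (intro phi_cong) auto
    thus ?thesis using False by simp
  qed
  have d2: "((\<lambda>t. form H (x(i := t))) has_real_derivative
      (\<Sum>e\<in>edges H. if i \<in> e then real k * psi e i x else 0)) (at (x i))"
    unfolding form_def by (intro DERIV_sum d1)
  have eq: "(\<Sum>e\<in>edges H. if i \<in> e then real k * psi e i x else 0) = real k * gradient H i x"
    using u(2) by (simp add: gradient_def sum_distrib_left sum.If_cases Int_def)
  have sums: "(\<Sum>j\<in>?V. (x(i := t)) j ^ k) = t ^ k + (\<Sum>j\<in>?V - {i}. x j ^ k)" for t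
    using u(1) i by (simp add: sum.remove[of ?V i])
  let ?D = "real k * (gradient H i x - ?R * x i ^ (k - 1))"
  \<comment> \<open>The function \<open>g\<close> is nonpositive on the nonnegative half-line and vanishes at \<open>x i\<close>.\<close>
  have dg: "(g has_real_derivative ?D) (at (x i))"
    unfolding g_def sums
    by (rule derivative_eq_intros d2[unfolded eq] refl)+ (simp add: algebra_simps)
  have "?D = 0"
  proof (cases "x i = 0")
    case True
    have "0 \<le> gradient H i x"
      unfolding gradient_def using u(3) x0 by (intro sum_nonneg psi_nonneg) auto
    hence "0 \<le> ?D" using True k_ge2 by (simp add: zero_power)
    moreover have "\<not> 0 < ?D"
    proof
      assume "0 < ?D"
      then obtain d where "d > 0" "\<And>h. 0 < h \<Longrightarrow> h < d \<Longrightarrow> g (x i) < g (x i + h)"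
        using DERIV_pos_inc_right[OF dg] by blast
      from this(2)[of "d / 2"] this(1) gle[of "d / 2"] show False
        using True g0 by simp
    qed
    ultimately show ?thesis by linarith
  next
    case False
    hence "0 < x i" using x0[OF i] by simp
    thus ?thesis
      by (intro DERIV_local_max[OF dg, of "x i"]) (auto simp: g0 intro!: gle)
  qed
  thus ?thesis using k_ge2 by simp
qed

lemma maximiserI:
  assumes H: "uniform_hypergraph k H" and x: "x \<in> nonneg_sphere (verts H)" "radius H \<le> form H x"
  shows "maximiser H x"
  using form_le_radius[OF H, of x] x by (auto simp: maximiser_def nonneg_sphere_def)

lemma radius_nonneg:
  assumes "uniform_hypergraph k H" "verts H \<noteq> {}"
  shows "0 \<le> radius H"
proof -
  obtain x where x: "maximiser H x" using maximiser_exists[OF assms] by blast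
  hence "0 \<le> x i" if "i \<in> verts H" for i
    using that by (simp add: maximiser_def nonneg_sphere_def)
  hence "0 \<le> (\<Sum>i\<in>verts H. x i * gradient H i x)"
    unfolding gradient_def using uniformD(3)[OF assms(1)]
    by (intro sum_nonneg mult_nonneg_nonneg psi_nonneg) auto
  thus ?thesis using x form_euler[OF assms(1), of x] by (simp add: maximiser_def)
qed

section \<open>The spectral radius of a tensor whose action is the gradient\<close>

text \<open>
  A maximiser is an eigenvector for the radius.  Conversely, for an eigenpair \<open>(l, y)\<close> the moduli
  satisfy \<open>\<bar>l\<bar> * \<bar>y i\<bar> ^ (k - 1) \<le> gradient H i \<bar>y\<bar>\<close>; multiplying by \<open>\<bar>y i\<bar>\<close> and summing gives the bound by
  Euler's identity.
\<close>

lemma tensor_spectral_radius_eq_radius: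
  assumes H: "uniform_hypergraph k H" and ne: "verts H \<noteq> {}"
    and T: "\<And>x i. i \<in> verts H \<Longrightarrow> tensor_apply k (verts H) T x i = gradient H i x"
  shows "tensor_spectral_radius k (verts H) T = radius H"
  unfolding tensor_spectral_radius_def
proof (rule Greatest_equality)
  let ?V = "verts H"
  obtain x where x: "maximiser H x" using maximiser_exists[OF H ne] by blast
  hence s: "(\<Sum>i\<in>?V. x i ^ k) = 1" by (simp add: maximiser_def nonneg_sphere_def)
  have "\<exists>i\<in>?V. x i \<noteq> 0"
  proof (rule ccontr)
    assume "\<not> (\<exists>i\<in>?V. x i \<noteq> 0)"
    hence "(\<Sum>i\<in>?V. x i ^ k) = 0" using k_ge2 by simp
    thus False using s by simp
  qed
  moreover have "gradient H i (\<lambda>j. complex_of_real (x j)) = of_real (gradient H i x)" for i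
    unfolding gradient_def psi_of_real by simp
  ultimately have "tensor_eigenvector k ?V T (of_real (radius H)) (\<lambda>j. of_real (x j))"
    unfolding tensor_eigenvector_def using T maximiser_eigen_equation[OF H x] by simp
  thus "\<exists>l. tensor_eigenvalue k ?V T l \<and> radius H = cmod l"
    unfolding tensor_eigenvalue_def using radius_nonneg[OF H ne]
    by (intro exI[of _ "of_real (radius H)"]) auto
next
  let ?V = "verts H"
  note u = uniformD[OF H]
  fix r assume "\<exists>l. tensor_eigenvalue k ?V T l \<and> r = cmod l"
  then obtain l y where r: "r = cmod l" and y: "tensor_eigenvector k ?V T l y"
    unfolding tensor_eigenvalue_def by blast
  let ?S = "\<Sum>i\<in>?V. cmod (y i) ^ k"
  obtain i where "i \<in> ?V" "y i \<noteq> 0" using y by (auto simp: tensor_eigenvector_def)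
  hence S: "0 < ?S" using u(1) by (intro sum_pos2[of _ i]) auto
  have "r * ?S = (\<Sum>i\<in>?V. cmod (y i) * cmod (l * y i ^ (k - 1)))"
    unfolding r power_k[of "cmod _"] by (simp add: sum_distrib_left norm_mult norm_power mult_ac)
  also have "\<dots> = (\<Sum>i\<in>?V. cmod (y i) * cmod (gradient H i y))"
    using y T by (simp add: tensor_eigenvector_def)
  also have "\<dots> \<le> (\<Sum>i\<in>?V. cmod (y i) * gradient H i (\<lambda>j. cmod (y j)))"
    unfolding gradient_def
    by (intro sum_mono mult_left_mono sum_norm_le norm_psi_le) auto
  also have "\<dots> = form H (\<lambda>j. cmod (y j))" by (rule form_euler[OF H])
  also have "\<dots> \<le> radius H * ?S" by (rule form_le_radius[OF H]) simp
  finally show "r \<le> radius H" using S by simp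
qed

section \<open>Positivity of maximisers\<close>

text \<open>
  Raising the zero coordinates \<open>B\<close> of an edge that also has positive coordinates to \<open>\<epsilon>\<close> gains at
  least a multiple of \<open>\<epsilon> ^ (k - 1)\<close>, because \<open>card B \<le> k - 1\<close>.
\<close>

lemma phi_perturb:
  fixes x :: "'v \<Rightarrow> real"
  assumes e: "finite e" "card e = k" and B: "B \<subset> e" "B \<noteq> {}"
    and x0: "\<And>i. i \<in> B \<Longrightarrow> x i = 0" and xp: "\<And>i. i \<in> e - B \<Longrightarrow> 0 < x i"
  shows "\<exists>\<delta>>0. \<forall>\<epsilon>. 0 < \<epsilon> \<and> \<epsilon> \<le> 1 \<longrightarrow>
           phi e x + \<delta> * \<epsilon> ^ (k - 1) \<le> phi e (\<lambda>i. if i \<in> B then \<epsilon> else x i)"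
proof (intro exI conjI allI impI; (elim conjE)?)
  let ?P = "\<Prod>i\<in>e - B. x i" and ?s = "\<Sum>i\<in>e. x i"
  have fB: "finite B" using e(1) B(1) finite_subset by blast
  have xn: "0 \<le> x i" if "i \<in> e" for i using x0 xp that by (cases "i \<in> B") (auto intro: less_imp_le)
  have P: "0 < ?P" using xp by (intro prod_pos) auto
  obtain j where "j \<in> e - B" using B(1) by blast
  hence s: "0 < ?s" using xp xn e(1) by (intro sum_pos2[of _ j]) auto
  show "0 < b * (real k * ?P) + c * ?s ^ (k - 1)"
  proof (cases "b = 0")
    case True
    thus ?thesis using bc_pos s by simp
  next
    case False
    thus ?thesis using nonneg P s k_ge2
      by (intro add_pos_nonneg mult_pos_pos mult_nonneg_nonneg) auto
  qed
  fix \<epsilon> :: real assume \<epsilon>: "0 < \<epsilon>" "\<epsilon> \<le> 1"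
  let ?y = "\<lambda>i. if i \<in> B then \<epsilon> else x i"
  have i1: "(\<Sum>i\<in>e. x i ^ k) \<le> (\<Sum>i\<in>e. ?y i ^ k)"
    using x0 xn \<epsilon> by (intro sum_mono power_mono) auto
  have "card B < k" using B(1) e psubset_card_mono by metis
  hence "\<epsilon> ^ (k - 1) \<le> \<epsilon> ^ card B" using \<epsilon> by (intro power_decreasing) auto
  hence "\<epsilon> ^ (k - 1) * ?P \<le> \<epsilon> ^ card B * ?P" using P by simp
  also have "\<dots> = (\<Prod>i\<in>B. ?y i) * (\<Prod>i\<in>e - B. ?y i)" by simp
  also have "\<dots> = (\<Prod>i\<in>e. ?y i)"
    using e(1) B(1) prod.subset_diff[of B e ?y] by (simp add: mult.commute psubset_imp_subset)
  finally have "\<epsilon> ^ (k - 1) * ?P \<le> (\<Prod>i\<in>e. ?y i)" .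
  moreover obtain m where m: "m \<in> B" using B(2) by blast
  moreover have "(\<Prod>i\<in>e. x i) = 0" using x0[OF m] m B(1) e(1) by (auto intro: prod_zero)
  ultimately have i2: "(\<Prod>i\<in>e. x i) + \<epsilon> ^ (k - 1) * ?P \<le> (\<Prod>i\<in>e. ?y i)"
    by simp
  have "?s + \<epsilon> = (\<Sum>i\<in>e. x i + (if i = m then \<epsilon> else 0))"
    using m B(1) e(1) by (auto simp: sum.distrib)
  also have "\<dots> \<le> (\<Sum>i\<in>e. ?y i)"
    using m x0 \<epsilon> by (intro sum_mono) auto
  finally have "(?s + \<epsilon>) ^ k \<le> (\<Sum>i\<in>e. ?y i) ^ k" using s \<epsilon> by (intro power_mono) auto
  moreover have "?s ^ k + \<epsilon> ^ (k - 1) * ?s ^ (k - 1) \<le> (?s + \<epsilon>) ^ k"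
  proof -
    have "\<epsilon> ^ (k - 1) \<le> \<epsilon> ^ 1" using \<epsilon> k_ge2 by (intro power_decreasing) auto
    hence "?s ^ k + \<epsilon> ^ (k - 1) * ?s ^ (k - 1) \<le> (?s + \<epsilon>) * ?s ^ (k - 1)"
      using s unfolding power_k[of ?s] by (simp add: distrib_right)
    also have "\<dots> \<le> (?s + \<epsilon>) * (?s + \<epsilon>) ^ (k - 1)"
      using s \<epsilon> by (intro mult_left_mono power_mono) auto
    finally show ?thesis unfolding power_k[of "?s + \<epsilon>"] .
  qed
  ultimately have i3: "?s ^ k + \<epsilon> ^ (k - 1) * ?s ^ (k - 1) \<le> (\<Sum>i\<in>e. ?y i) ^ k" by linarith
  have "a * (\<Sum>i\<in>e. x i ^ k) + b * (real k * ((\<Prod>i\<in>e. x i) + \<epsilon> ^ (k - 1) * ?P))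
      + c * (?s ^ k + \<epsilon> ^ (k - 1) * ?s ^ (k - 1)) \<le> phi e ?y"
    unfolding phi_def
    by (intro add_mono mult_left_mono i1 i2 i3 nonneg) auto
  thus "phi e x + (b * (real k * ?P) + c * ?s ^ (k - 1)) * \<epsilon> ^ (k - 1) \<le> phi e ?y"
    unfolding phi_def by (simp add: algebra_simps)
qed

text \<open>
  Otherwise some edge meets both the support of \<open>x\<close> and its complement.  Raising the zeros of that
  edge to \<open>\<epsilon>\<close> gains order \<open>\<epsilon> ^ (k - 1)\<close> in the form but costs only order \<open>\<epsilon> ^ k\<close> in the
  normalisation, which contradicts maximality.
\<close>

lemma maximiser_pos:
  assumes H: "uniform_hypergraph k H" and ind: "indecomposable H" and x: "maximiser H x"
    and i: "i \<in> verts H"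
  shows "0 < x i"
proof (rule ccontr)
  assume xi: "\<not> 0 < x i"
  note u = uniformD[OF H]
  let ?V = "verts H" and ?R = "radius H"
  have x0: "\<And>j. j \<in> ?V \<Longrightarrow> 0 \<le> x j" and x1: "(\<Sum>j\<in>?V. x j ^ k) = 1" and xF: "form H x = ?R"
    using x by (auto simp: maximiser_def nonneg_sphere_def)
  define S where "S = {j \<in> ?V. 0 < x j}"
  have "S \<noteq> {}"
  proof
    assume "S = {}"
    hence "x j = 0" if "j \<in> ?V" for j using x0[OF that] that by (force simp: S_def)
    hence "(\<Sum>j\<in>?V. x j ^ k) = 0" using k_ge2 by simp
    thus False using x1 by simp
  qed
  moreover have "S \<noteq> ?V" using i xi by (auto simp: S_def)
  moreover have "S \<subseteq> ?V" by (auto simp: S_def)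
  ultimately obtain e where e: "e \<in> edges H" "e \<inter> S \<noteq> {}" "\<not> e \<subseteq> S"
    using ind unfolding indecomposable_def by metis
  define B where "B = e - S"
  have B: "B \<subset> e" "B \<noteq> {}" "B \<subseteq> ?V" using e u(3)[OF e(1)] by (auto simp: B_def)
  have xB: "x j = 0" if "j \<in> B" for j
    using x0[of j] B(3) that by (force simp: B_def S_def)
  have xe: "0 < x j" if "j \<in> e - B" for j
    using that by (auto simp: B_def S_def)
  obtain \<delta> where \<delta>: "0 < \<delta>"
    and gain: "\<And>\<epsilon>. 0 < \<epsilon> \<Longrightarrow> \<epsilon> \<le> 1 \<Longrightarrow>
           phi e x + \<delta> * \<epsilon> ^ (k - 1) \<le> phi e (\<lambda>i. if i \<in> B then \<epsilon> else x i)"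
    using phi_perturb[OF u(5)[OF e(1)] u(4)[OF e(1)] B(1,2), where x = x, OF xB xe] by auto
  \<comment> \<open>The constant \<open>\<epsilon>\<close> is chosen such that the cost \<open>M * \<epsilon> ^ k\<close> is below the gain \<open>\<delta> * \<epsilon> ^ (k - 1)\<close>.\<close>
  define M where "M = \<bar>?R\<bar> * real (card B)"
  define \<epsilon> where "\<epsilon> = min 1 (\<delta> / (M + 1))"
  have M: "0 \<le> M" by (simp add: M_def)
  have \<epsilon>: "0 < \<epsilon>" "\<epsilon> \<le> 1" using \<delta> M by (auto simp: \<epsilon>_def)
  have "M * \<epsilon> < \<delta>"
  proof -
    have "\<epsilon> \<le> \<delta> / (M + 1)" by (simp add: \<epsilon>_def)
    hence "\<epsilon> * (M + 1) \<le> \<delta>" using M by (simp add: pos_le_divide_eq)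
    thus ?thesis using \<epsilon> by (simp add: algebra_simps)
  qed
  let ?y = "\<lambda>i. if i \<in> B then \<epsilon> else x i"
  have y0: "0 \<le> ?y j" if "j \<in> ?V" for j using x0 \<epsilon> that by simp
  have "form H x + \<delta> * \<epsilon> ^ (k - 1) \<le> form H ?y"
  proof -
    have "(\<Sum>f\<in>edges H - {e}. phi f x) \<le> (\<Sum>f\<in>edges H - {e}. phi f ?y)"
      using u(3) x0 xB \<epsilon> by (intro sum_mono phi_mono) auto
    thus ?thesis
      using gain[OF \<epsilon>] u(2) e(1) by (simp add: form_def sum.remove[of "edges H" e])
  qed
  also have "form H ?y \<le> ?R * (\<Sum>j\<in>?V. ?y j ^ k)" by (rule form_le_radius[OF H y0])
  also have "(\<Sum>j\<in>?V. ?y j ^ k) = 1 + real (card B) * \<epsilon> ^ k"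
  proof -
    have "(\<Sum>j\<in>?V. ?y j ^ k) = (\<Sum>j\<in>?V. x j ^ k + (if j \<in> B then \<epsilon> ^ k else 0))"
      using xB k_ge2 by (intro sum.cong) auto
    thus ?thesis using x1 u(1) B(3)
      by (simp add: sum.distrib sum.If_cases Int_absorb1)
  qed
  finally have "\<delta> * \<epsilon> ^ (k - 1) \<le> ?R * real (card B) * \<epsilon> ^ k"
    using xF by (simp add: algebra_simps)
  also have "\<dots> \<le> M * \<epsilon> ^ k" unfolding M_def using \<epsilon> by (intro mult_right_mono) auto
  also have "\<dots> = M * \<epsilon> * \<epsilon> ^ (k - 1)" unfolding power_k[of \<epsilon>] by simp
  finally have "\<delta> \<le> M * \<epsilon>" using \<epsilon> by simp
  thus False using \<open>M * \<epsilon> < \<delta>\<close> by simp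
qed

section \<open>Isomorphisms and moving edges\<close>

text \<open>
  By symmetry isomorphic hypergraphs have equal radii; one inequality suffices here.
\<close>

lemma radius_le_of_iso:
  assumes H: "uniform_hypergraph k H" and H': "uniform_hypergraph k H'" "verts H' \<noteq> {}"
    and f: "bij_betw f (verts H) (verts H')" and E: "edges H' = image f ` edges H"
  shows "radius H' \<le> radius H"
proof -
  note u = uniformD[OF H]
  obtain x where x: "maximiser H' x" using maximiser_exists[OF H'] by blast
  have inj: "inj_on f (verts H)" and im: "f ` verts H = verts H'"
    using f by (auto simp: bij_betw_def)
  have "inj_on (image f) (edges H)"
    using inj_on_subset[OF inj_on_image_Pow[OF inj]] u(3) by blast
  hence "form H' x = (\<Sum>e\<in>edges H. phi (f ` e) x)"
    unfolding form_def E by (simp add: sum.reindex)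
  also have "\<dots> = form H (x \<circ> f)"
    unfolding form_def by (intro sum.cong refl phi_image inj_on_subset[OF inj] u(3))
  also have "\<dots> \<le> radius H * (\<Sum>i\<in>verts H. (x \<circ> f) i ^ k)"
    using x im by (intro form_le_radius[OF H]) (auto simp: maximiser_def nonneg_sphere_def)
  also have "(\<Sum>i\<in>verts H. (x \<circ> f) i ^ k) = (\<Sum>i\<in>verts H'. x i ^ k)"
    using sum.reindex_bij_betw[OF f, of "\<lambda>i. x i ^ k"] by simp
  finally show ?thesis using x by (simp add: maximiser_def nonneg_sphere_def)
qed

text \<open>
  The hypothesis \<open>disj\<close> says that no moved edge coincides with an edge that stays in place.
\<close>

lemma radius_less_move_edges:
  assumes H: "uniform_hypergraph k H" and ind: "indecomposable H" and x: "maximiser H x"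
    and w: "r \<in> verts H" "w \<in> verts H" and le: "x r \<le> x w"
    and M: "M \<subseteq> edges H" "M \<noteq> {}" "\<And>e. e \<in> M \<Longrightarrow> r \<in> e \<and> w \<notin> e"
    and disj: "swap_vertex r w ` M \<inter> (edges H - M) = {}"
  shows "radius H < radius (move_edges r w M H)"
proof (rule ccontr)
  let ?H' = "move_edges r w M H"
  assume "\<not> radius H < radius ?H'"
  hence rad: "radius ?H' \<le> radius H" by simp
  note u = uniformD[OF H]
  have H': "uniform_hypergraph k ?H'" by (rule move_edges_uniform[OF H w(2) M(1,3)])
  note u' = uniformD[OF H']
  have pos: "0 < x j" if "j \<in> verts H" for j using maximiser_pos[OF H ind x that] .
  have fM: "finite M" using M(1) u(2) finite_subset by blast
  have inj: "inj_on (swap_vertex r w) M"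
  proof (rule inj_onI)
    fix e f assume "e \<in> M" "f \<in> M" "swap_vertex r w e = swap_vertex r w f"
    moreover have "insert r (swap_vertex r w e - {w}) = e" if "e \<in> M" for e
      using M(3)[OF that] by (auto simp: swap_vertex_def)
    ultimately show "e = f" by metis
  qed
  have phi_le: "phi e x \<le> phi (swap_vertex r w e) x" if e: "e \<in> M" for e
  proof -
    have eE: "e \<in> edges H" using e M(1) by auto
    let ?g = "\<lambda>i. if i = r then w else i"
    have sw: "swap_vertex r w e = ?g ` e" using M(3)[OF e] by (auto simp: swap_vertex_def)
    have "inj_on ?g e" using M(3)[OF e] by (auto simp: inj_on_def)
    hence "phi (swap_vertex r w e) x = phi e (x \<circ> ?g)" unfolding sw by (rule phi_image)
    moreover have "phi e x \<le> phi e (x \<circ> ?g)"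
      using u(3)[OF eE] pos le by (intro phi_mono) (auto intro: less_imp_le)
    ultimately show ?thesis by simp
  qed
  have "form H x = (\<Sum>e\<in>edges H - M. phi e x) + (\<Sum>e\<in>M. phi e x)"
    unfolding form_def using sum.subset_diff[OF M(1) u(2)] by simp
  also have "\<dots> \<le> (\<Sum>e\<in>edges H - M. phi e x) + (\<Sum>e\<in>M. phi (swap_vertex r w e) x)"
    by (intro add_left_mono sum_mono phi_le)
  also have "\<dots> = form ?H' x"
    unfolding form_def move_edges_def using u(2) fM disj inj
    by (simp add: sum.union_disjoint Int_commute sum.reindex)
  finally have mono: "form H x \<le> form ?H' x" .
  hence "radius ?H' \<le> form ?H' x" using x rad by (simp add: maximiser_def)
  hence x': "maximiser ?H' x" using x by (intro maximiserI[OF H']) (auto simp: maximiser_def move_edges_def)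
  have req: "radius ?H' = radius H"
    using mono x x' rad by (simp add: maximiser_def)
  \<comment> \<open>The eigenvalue equations at \<open>w\<close> differ by the positive contribution of the moved edges.\<close>
  have split: "{e \<in> edges ?H'. w \<in> e} = {e \<in> edges H. w \<in> e} \<union> swap_vertex r w ` M"
    using M(1,3) by (auto simp: move_edges_def swap_vertex_def)
  have "{e \<in> edges H. w \<in> e} \<inter> swap_vertex r w ` M = {}"
    using disj M(3) by blast
  hence "gradient ?H' w x = gradient H w x + (\<Sum>e\<in>swap_vertex r w ` M. psi e w x)"
    unfolding gradient_def split using u(2) fM by (simp add: sum.union_disjoint)
  moreover have "0 < (\<Sum>e\<in>swap_vertex r w ` M. psi e w x)"
  proof (rule sum_pos)
    fix e assume e: "e \<in> swap_vertex r w ` M"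
    hence e': "e \<in> edges ?H'" "w \<in> e" by (auto simp: move_edges_def swap_vertex_def)
    thus "0 < psi e w x"
      using u'(5) u'(3)[OF e'(1)] pos by (intro psi_pos) (auto simp: move_edges_def)
  qed (use fM M(2) in auto)
  moreover have "gradient ?H' w x = gradient H w x"
    using maximiser_eigen_equation[OF H x w(2)] maximiser_eigen_equation[OF H' x', of w] w(2) req
    by (simp add: move_edges_def)
  ultimately show False by simp
qed

end

section \<open>Attached paths\<close>

lemma indecomposable_of_connected:
  assumes "connected_hypergraph G"
  shows "indecomposable G"
  unfolding indecomposable_def
proof (intro allI impI)
  fix S assume S: "S \<subseteq> verts G" "S \<noteq> {}" and cl: "\<forall>e\<in>edges G. e \<inter> S \<noteq> {} \<longrightarrow> e \<subseteq> S"
  obtain u where u: "u \<in> S" using S by blast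
  have "w \<in> S" if w: "w \<in> verts G" for w
  proof -
    obtain ws fs where p: "hpath G ws fs" "hd ws = u" "last ws = w"
      using assms w subsetD[OF S(1) u] unfolding connected_hypergraph_def by metis
    have len: "length ws = Suc (length fs)" and sub: "set fs \<subseteq> edges G"
      and inc: "\<And>j. j < length fs \<Longrightarrow> ws ! j \<in> fs ! j \<and> ws ! Suc j \<in> fs ! j"
      using p(1) by (simp_all add: hpath_def)
    have ne: "ws \<noteq> []" using len by (metis length_0_conv nat.distinct(1))
    have "j \<le> length fs \<longrightarrow> ws ! j \<in> S" for j
    proof (induction j)
      case 0
      show ?case using p(2) u hd_conv_nth[OF ne] by metis
    next
      case (Suc j)
      show ?case
      proof
        assume "Suc j \<le> length fs"
        hence j: "j < length fs" "ws ! j \<in> S" using Suc.IH by auto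
        have "fs ! j \<in> edges G" using j(1) sub nth_mem by blast
        thus "ws ! Suc j \<in> S" using cl inc[OF j(1)] j(2) by blast
      qed
    qed
    moreover have "ws ! length fs = w"
      using p(3) last_conv_nth[OF ne] len by (metis diff_Suc_1)
    ultimately show ?thesis by blast
  qed
  thus "S = verts G" using S by blast
qed

lemma path_edge_in_attach_paths:
  assumes "1 \<le> i" "i \<le> (if s then p else q)"
  shows "path_edge k v s i \<in> edges (attach_paths k G v p q)"
  using assms by (cases s) (auto simp: attach_paths_def)

lemma mem_verts_attach_paths [simp]:
  "Old z \<in> verts (attach_paths k G v p q) \<longleftrightarrow> z \<in> verts G"
  "New s i j \<in> verts (attach_paths k G v p q) \<longleftrightarrow>
     1 \<le> i \<and> i \<le> (if s then p else q) \<and> j < k - 1"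
  by (auto simp: attach_paths_def)

lemma mem_path_edge:
  assumes "1 \<le> l"
  shows "New s i j \<in> path_edge k v t l \<longleftrightarrow>
    s = t \<and> (l = i \<and> j < k - 1 \<or> l = Suc i \<and> i > 0 \<and> j = 0)"
    and "Old z \<in> path_edge k v t l \<longleftrightarrow> z = v \<and> l = 1"
  using assms by (auto simp: path_edge_def joint_def)

lemma path_edge_inject:
  assumes "2 \<le> k" "1 \<le> i" "1 \<le> l" "path_edge k v s i = path_edge k v t l"
  shows "s = t \<and> i = l"
proof -
  have "New s i 0 \<in> path_edge k v s i" "New t l 0 \<in> path_edge k v t l"
    using assms(1) by (auto simp: path_edge_def)
  hence "New s i 0 \<in> path_edge k v t l" "New t l 0 \<in> path_edge k v s i"
    unfolding assms(4) by blast+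
  thus ?thesis using assms(2,3) by (auto simp: mem_path_edge)
qed

lemma Old_image_neq_path_edge:
  assumes "2 \<le> k"
  shows "Old ` e \<noteq> path_edge k v s i"
proof -
  have "New s i 0 \<in> path_edge k v s i" using assms by (auto simp: path_edge_def)
  thus ?thesis by blast
qed

lemma path_edge_eq:
  assumes "2 \<le> k" "1 \<le> i"
  shows "path_edge k v s i = insert (joint v s (i - 1)) (insert (joint v s i) (New s i ` {1..<k - 1}))"
proof -
  have "{New s i j |j. j < k - 1} = New s i ` {..<k - 1}" by blast
  also have "{..<k - 1} = insert 0 {1..<k - 1}" using assms(1) by auto
  also have "New s i ` insert 0 {1..<k - 1} = insert (joint v s i) (New s i ` {1..<k - 1})"
    using assms(2) by (simp add: joint_def)
  finally show ?thesis unfolding path_edge_def by simp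
qed

lemma attach_paths_indecomposable:
  assumes k: "2 \<le> k" and conn: "connected_hypergraph G" and v: "v \<in> verts G"
  shows "indecomposable (attach_paths k G v p q)"
  unfolding indecomposable_def
proof (intro allI impI)
  let ?H = "attach_paths k G v p q"
  fix S assume S: "S \<subseteq> verts ?H" "S \<noteq> {}" and cl: "\<forall>e\<in>edges ?H. e \<inter> S \<noteq> {} \<longrightarrow> e \<subseteq> S"
  have rng: "1 \<le> i \<and> i \<le> (if s then p else q) \<and> j < k - 1" if "New s i j \<in> verts ?H" for s i j
    using that by simp
  have down: "New s i j \<in> S \<Longrightarrow> Old v \<in> S" for s i j
  proof (induction i arbitrary: j)
    case 0
    thus ?case using rng[of s 0 j] S by auto
  next
    case (Suc i)
    have "New s (Suc i) j \<in> path_edge k v s (Suc i)"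
      using rng[of s "Suc i" j] Suc.prems S by (auto simp: path_edge_def)
    hence "path_edge k v s (Suc i) \<subseteq> S"
      using cl path_edge_in_attach_paths[of "Suc i" s p q k v G] rng[of s "Suc i" j] Suc.prems S by blast
    hence "joint v s i \<in> S" by (simp add: path_edge_def)
    thus ?case using Suc.IH by (auto simp: joint_def split: if_splits)
  qed
  define T where "T = {z \<in> verts G. Old z \<in> S}"
  have "T \<noteq> {}"
  proof -
    obtain y where "y \<in> S" using S by blast
    thus ?thesis using down S v by (cases y) (auto simp: T_def attach_paths_def)
  qed
  moreover have "\<forall>e\<in>edges G. e \<inter> T \<noteq> {} \<longrightarrow> e \<subseteq> T"
  proof (intro ballI impI)
    fix e assume e: "e \<in> edges G" "e \<inter> T \<noteq> {}"
    hence "Old ` e \<in> edges ?H" "Old ` e \<inter> S \<noteq> {}" by (auto simp: attach_paths_def T_def)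
    hence "Old ` e \<subseteq> S" using cl by blast
    thus "e \<subseteq> T" using S by (auto simp: T_def attach_paths_def)
  qed
  ultimately have T: "T = verts G"
    using indecomposable_of_connected[OF conn] unfolding indecomposable_def by (auto simp: T_def)
  have up: "i \<le> (if s then p else q) \<Longrightarrow> joint v s i \<in> S \<and> (1 \<le> i \<longrightarrow> path_edge k v s i \<subseteq> S)" for s i
  proof (induction i)
    case 0
    thus ?case using T v by (auto simp: T_def joint_def)
  next
    case (Suc i)
    have "joint v s i \<in> S" using Suc by simp
    moreover have "joint v s i \<in> path_edge k v s (Suc i)" by (simp add: path_edge_def)
    moreover have "path_edge k v s (Suc i) \<in> edges ?H"
      using Suc.prems by (intro path_edge_in_attach_paths) simp_all
    ultimately have "path_edge k v s (Suc i) \<subseteq> S" using cl by blast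
    moreover have "joint v s (Suc i) \<in> path_edge k v s (Suc i)"
      using k by (simp add: path_edge_eq)
    ultimately show ?case by blast
  qed
  have "y \<in> S" if y: "y \<in> verts ?H" for y
  proof (cases y)
    case (Old z)
    thus ?thesis using y T by (auto simp: T_def attach_paths_def)
  next
    case (New s i j)
    have r: "1 \<le> i" "i \<le> (if s then p else q)" "j < k - 1" using rng y New by auto
    hence "y \<in> path_edge k v s i" using New by (auto simp: path_edge_def)
    thus ?thesis using up[OF r(2)] r(1) by blast
  qed
  thus "S = verts ?H" using S by blast
qed

lemma exists_edge_at:
  assumes "2 \<le> k" "uniform_hypergraph k G" "connected_hypergraph G" "edges G \<noteq> {}" "v \<in> verts G"
  shows "\<exists>e\<in>edges G. v \<in> e"
proof (rule ccontr)
  assume "\<not> ?thesis"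
  hence "{v} = verts G"
    using indecomposable_of_connected[OF assms(3)] assms(5) unfolding indecomposable_def by blast
  moreover obtain e where e: "e \<in> edges G" using assms(4) by blast
  ultimately have "e \<subseteq> {v}" "card e = k" using uniformD[OF assms(2)] by auto
  thus False using card_mono[of "{v}" e] assms(1) by simp
qed

text \<open>
  Moving the \<open>(p + 1)\<close>-st path edge from the end vertex of the \<open>p\<close>-th one to the root splits the path
  of length \<open>p + q\<close> into two paths of lengths \<open>p\<close> and \<open>q\<close> at the root.
\<close>

lemma move_path_to_root_iso:
  fixes G :: "'a hypergraph" and v :: 'a
  assumes k: "2 \<le> k" and pq: "p \<noteq> 0" "q \<noteq> 0"
  defines "H' \<equiv> attach_paths k G v p q"
    and "N \<equiv> move_edges (New True p 0) (Old v) {path_edge k v True (p + 1)} (attach_paths k G v (p + q) 0)"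
  obtains f where "bij_betw f (verts H') (verts N)" "edges N = image f ` edges H'"
proof -
  define f where "f = (\<lambda>y :: 'a ext_vertex. case y of Old z \<Rightarrow> Old z
    | New s i j \<Rightarrow> if s then New True i j else New True (p + i) j)"
  define g where "g = (\<lambda>y :: 'a ext_vertex. case y of Old z \<Rightarrow> Old z
    | New s i j \<Rightarrow> if i \<le> p then New True i j else New False (i - p) j)"
  have f[simp]: "f (Old z) = Old z" "f (New True i j) = New True i j"
    "f (New False i j) = New True (p + i) j" for z i j by (auto simp: f_def)
  have bij: "bij_betw f (verts H') (verts N)"
  proof (rule bij_betw_byWitness[where f' = g])
    show "\<forall>y\<in>verts H'. g (f y) = y"
    proof
      fix y assume "y \<in> verts H'"
      thus "g (f y) = y" using pq by (cases y) (auto simp: H'_def f_def g_def)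
    qed
    show "\<forall>y\<in>verts N. f (g y) = y"
    proof
      fix y assume "y \<in> verts N"
      thus "f (g y) = y" using pq by (cases y) (auto simp: N_def move_edges_def f_def g_def split: if_splits)
    qed
    show "f ` verts H' \<subseteq> verts N"
    proof (rule image_subsetI)
      fix y assume "y \<in> verts H'"
      thus "f y \<in> verts N"
        using pq by (cases y) (auto simp: H'_def N_def move_edges_def f_def split: if_splits)
    qed
    show "g ` verts N \<subseteq> verts H'"
    proof (rule image_subsetI)
      fix y assume "y \<in> verts N"
      thus "g y \<in> verts H'"
        using pq by (cases y) (auto simp: H'_def N_def move_edges_def g_def split: if_splits)
    qed
  qed
  have fo: "f ` (Old ` e) = Old ` e" for e by (simp add: image_image)
  have fT: "f ` path_edge k v True i = path_edge k v True i" if "1 \<le> i" for i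
    using k that by (simp add: path_edge_eq joint_def image_image)
  have fF: "f ` path_edge k v False i = path_edge k v True (p + i)" if "2 \<le> i" for i
    using k that by (simp add: path_edge_eq joint_def image_image)
  have fF1: "f ` path_edge k v False 1 =
      swap_vertex (New True p 0) (Old v) (path_edge k v True (p + 1))"
    using k pq by (auto simp: path_edge_eq joint_def image_image swap_vertex_def)
  have ne: "path_edge k v True i \<noteq> path_edge k v True (p + 1)" if "i \<in> {1..p + q} - {p + 1}" for i
    using path_edge_inject[OF k, of i "p + 1" v True True] that by auto
  have oe: "Old ` e \<noteq> path_edge k v True (p + 1)" for e by (rule Old_image_neq_path_edge[OF k])
  have eN: "edges N = ((`) Old ` edges G \<union> path_edge k v True ` ({1..p + q} - {p + 1}))
      \<union> {swap_vertex (New True p 0) (Old v) (path_edge k v True (p + 1))}"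
  proof -
    let ?f = "path_edge k v True (p + 1)"
    have "(`) Old ` edges G - {?f} = (`) Old ` edges G" using oe by blast
    moreover have "path_edge k v True ` {1..p + q} - {?f} = path_edge k v True ` ({1..p + q} - {p + 1})"
      using ne by blast
    ultimately show ?thesis
      unfolding N_def move_edges_def attach_paths_def by (simp add: Un_Diff)
  qed
  let ?sw = "swap_vertex (New True p 0) (Old v) (path_edge k v True (p + 1))"
  have iT: "(\<lambda>i. f ` path_edge k v True i) ` {1..p} = path_edge k v True ` {1..p}"
    by (intro image_cong refl fT) auto
  have iF: "(\<lambda>i. f ` path_edge k v False i) ` {1..q} = insert ?sw (path_edge k v True ` {p + 2..p + q})"
  proof -
    have "{1..q} = insert 1 {2..q}" using pq by auto
    hence "(\<lambda>i. f ` path_edge k v False i) ` {1..q} = insert ?sw ((\<lambda>i. f ` path_edge k v False i) ` {2..q})"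
      using fF1 by simp
    also have "(\<lambda>i. f ` path_edge k v False i) ` {2..q} = path_edge k v True ` (+) p ` {2..q}"
      unfolding image_image by (intro image_cong refl fF) auto
    also have "(+) p ` {2..q} = {p + 2..p + q}" by (simp add: add.commute)
    finally show ?thesis .
  qed
  have "image f ` edges H' = (`) Old ` edges G \<union> (\<lambda>i. f ` path_edge k v True i) ` {1..p}
      \<union> (\<lambda>i. f ` path_edge k v False i) ` {1..q}"
    unfolding H'_def attach_paths_def by (simp add: image_Un image_image)
  also have "\<dots> = (`) Old ` edges G \<union> path_edge k v True ` ({1..p} \<union> {p + 2..p + q}) \<union> {?sw}"
    unfolding iT iF image_Un by blast
  also have "{1..p} \<union> {p + 2..p + q} = {1..p + q} - {p + 1}" by auto
  also have "(`) Old ` edges G \<union> path_edge k v True ` ({1..p + q} - {p + 1}) \<union> {?sw} = edges N"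
    by (rule eN[symmetric])
  finally show ?thesis using that bij by metis
qed

text \<open>
  Moving the edges of \<open>G\<close> from the root to the end vertex \<open>New True p 0\<close> of the \<open>p\<close>-th path edge
  makes that vertex the root.  The isomorphism exchanges it with \<open>Old v\<close> and reverses the first
  \<open>p\<close> path edges.
\<close>

lemma move_root_along_path_iso:
  fixes G :: "'a hypergraph"
  assumes k: "2 \<le> k" and v: "v \<in> verts G" and pq: "p \<noteq> 0" "q \<noteq> 0"
  defines "H' \<equiv> attach_paths k G v p q"
    and "N \<equiv> move_edges (Old v) (New True p 0) {Old ` e |e. e \<in> edges G \<and> v \<in> e}
                (attach_paths k G v (p + q) 0)"
  obtains f where "bij_betw f (verts H') (verts N)" "edges N = image f ` edges H'"
proof -
  define f where "f = (\<lambda>y :: 'a ext_vertex. case y of Old z \<Rightarrow> if z = v then New True p 0 else Old z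
    | New s i j \<Rightarrow> if s then (if j = 0 then joint v True (p - i) else New True (p + 1 - i) j)
                   else New True (p + i) j)"
  define g where "g = (\<lambda>y :: 'a ext_vertex. case y of Old z \<Rightarrow> if z = v then New True p 0 else Old z
    | New s i j \<Rightarrow> if i \<le> p then (if j = 0 then joint v True (p - i) else New True (p + 1 - i) j)
                   else New False (i - p) j)"
  have f[simp]: "f (Old z) = (if z = v then New True p 0 else Old z)"
    "f (New True i j) = (if j = 0 then joint v True (p - i) else New True (p + 1 - i) j)"
    "f (New False i j) = New True (p + i) j" for z i j by (auto simp: f_def)
  have bij: "bij_betw f (verts H') (verts N)"
  proof (rule bij_betw_byWitness[where f' = g])
    show "\<forall>y\<in>verts H'. g (f y) = y"
    proof
      fix y assume "y \<in> verts H'"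
      thus "g (f y) = y" using pq by (cases y) (auto simp: H'_def f_def g_def joint_def)
    qed
    show "\<forall>y\<in>verts N. f (g y) = y"
    proof
      fix y assume "y \<in> verts N"
      thus "f (g y) = y" using pq by (cases y) (auto simp: N_def move_edges_def f_def g_def joint_def split: if_splits)
    qed
    show "f ` verts H' \<subseteq> verts N"
    proof (rule image_subsetI)
      fix y assume "y \<in> verts H'"
      thus "f y \<in> verts N"
        using k v pq
        by (cases y) (auto simp: H'_def N_def move_edges_def f_def joint_def split: if_splits)
    qed
    show "g ` verts N \<subseteq> verts H'"
    proof (rule image_subsetI)
      fix y assume "y \<in> verts N"
      thus "g y \<in> verts H'"
        using k v pq
        by (cases y) (auto simp: H'_def N_def move_edges_def g_def joint_def split: if_splits)
    qed
  qed
  have fo1: "f ` (Old ` e) = Old ` e" if "v \<notin> e" for e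
    using that by (force simp: image_image)
  have fo2: "f ` (Old ` e) = swap_vertex (Old v) (New True p 0) (Old ` e)" if "v \<in> e" for e
    using that unfolding swap_vertex_def by (force simp: image_image)
  have fT: "f ` path_edge k v True i = path_edge k v True (p + 1 - i)" if "1 \<le> i" "i \<le> p" for i
  proof -
    have "f (joint v True (i - 1)) = joint v True (p + 1 - i)" "f (joint v True i) = joint v True (p - i)"
      using that by (auto simp: joint_def)
    moreover have "f ` (New True i ` {1..<k - 1}) = New True (p + 1 - i) ` {1..<k - 1}"
      by (auto simp: image_image intro!: image_cong)
    moreover have "1 \<le> p + 1 - i" "p + 1 - i - 1 = p - i" using that by auto
    ultimately show ?thesis
      by (simp only: path_edge_eq[OF k] that image_insert insert_commute)
  qed
  have fF: "f ` path_edge k v False i = path_edge k v True (p + i)" if "1 \<le> i" for i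
    using k that pq by (auto simp: path_edge_eq joint_def image_image)
  let ?A = "{e \<in> edges G. v \<notin> e}" and ?B = "{e \<in> edges G. v \<in> e}"
  let ?sw = "swap_vertex (Old v) (New True p 0)"
  have eG: "edges G = ?A \<union> ?B" by auto
  have iO: "image f ` image Old ` edges G = (`) Old ` ?A \<union> (\<lambda>e. ?sw (Old ` e)) ` ?B"
  proof -
    have "image f ` image Old ` ?A = (`) Old ` ?A"
      unfolding image_image[of "image f"] by (intro image_cong refl fo1) auto
    moreover have "image f ` image Old ` ?B = (\<lambda>e. ?sw (Old ` e)) ` ?B"
      unfolding image_image[of "image f"] by (intro image_cong refl fo2) auto
    ultimately show ?thesis by (subst eG) (simp only: image_Un)
  qed
  have iT: "(\<lambda>i. f ` path_edge k v True i) ` {1..p} = path_edge k v True ` {1..p}"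
  proof -
    have "(\<lambda>i. f ` path_edge k v True i) ` {1..p} = path_edge k v True ` (\<lambda>i. p + 1 - i) ` {1..p}"
      unfolding image_image by (intro image_cong refl fT) auto
    also have "(\<lambda>i. p + 1 - i) ` {1..p} = {1..p}"
    proof -
      have "i \<in> (\<lambda>i. p + 1 - i) ` {1..p}" if "i \<in> {1..p}" for i
        using that by (intro image_eqI[of _ _ "p + 1 - i"]) auto
      thus ?thesis by auto
    qed
    finally show ?thesis .
  qed
  have iF: "(\<lambda>i. f ` path_edge k v False i) ` {1..q} = path_edge k v True ` {p + 1..p + q}"
  proof -
    have "(\<lambda>i. f ` path_edge k v False i) ` {1..q} = path_edge k v True ` (+) p ` {1..q}"
      unfolding image_image by (intro image_cong refl fF) auto
    also have "(+) p ` {1..q} = {p + 1..p + q}" by (simp add: add.commute)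
    finally show ?thesis .
  qed
  have eN: "edges N = (`) Old ` ?A \<union> path_edge k v True ` {1..p + q} \<union> (\<lambda>e. ?sw (Old ` e)) ` ?B"
  proof -
    let ?M = "{Old ` e |e. e \<in> edges G \<and> v \<in> e}"
    have M: "?M = (`) Old ` ?B" by (rule setcompr_eq_image)
    have "inj ((`) Old :: 'a set \<Rightarrow> 'a ext_vertex set)"
      by (intro injI) (simp add: inj_image_eq_iff inj_def)
    hence "(`) Old ` edges G - ?M = (`) Old ` (edges G - ?B)" unfolding M by (rule image_set_diff[symmetric])
    also have "edges G - ?B = ?A" by blast
    finally have "(`) Old ` edges G - ?M = (`) Old ` ?A" .
    moreover have "path_edge k v True ` {1..p + q} - ?M = path_edge k v True ` {1..p + q}"
    proof (intro Diff_triv equals0I)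
      fix e assume e: "e \<in> path_edge k v True ` {1..p + q} \<inter> ?M"
      obtain i where "e = path_edge k v True i" using e by blast
      moreover obtain e' where "e = Old ` e'" using e by blast
      ultimately show False using Old_image_neq_path_edge[OF k] by metis
    qed
    moreover have "?sw ` ?M = (\<lambda>e. ?sw (Old ` e)) ` ?B" unfolding M image_image ..
    moreover have "edges N = ((`) Old ` edges G - ?M) \<union> (path_edge k v True ` {1..p + q} - ?M) \<union> ?sw ` ?M"
      unfolding N_def move_edges_def attach_paths_def by (simp add: Un_Diff)
    ultimately show ?thesis by (simp only:)
  qed
  have "{1..p + q} = {1..p} \<union> {p + 1..p + q}" by auto
  hence split: "path_edge k v True ` {1..p + q}
      = path_edge k v True ` {1..p} \<union> path_edge k v True ` {p + 1..p + q}" by (simp only: image_Un)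
  have "image f ` edges H' = image f ` image Old ` edges G
      \<union> (\<lambda>i. f ` path_edge k v True i) ` {1..p} \<union> (\<lambda>i. f ` path_edge k v False i) ` {1..q}"
    unfolding H'_def attach_paths_def by (simp add: image_Un image_image)
  hence "edges N = image f ` edges H'" unfolding iO iT iF eN split by (simp only: Un_ac)
  thus ?thesis using that bij by metis
qed

context edge_form
begin

text \<open>
  One of the two moves goes towards the vertex with the larger coordinate of a maximiser.
\<close>

theorem radius_attach_paths_less:
  assumes G: "uniform_hypergraph k G" and conn: "connected_hypergraph G" and ne: "edges G \<noteq> {}"
    and v: "v \<in> verts G" and pq: "p \<noteq> 0" "q \<noteq> 0"
  shows "radius (attach_paths k G v (p + q) 0) < radius (attach_paths k G v p q)"
proof -
  let ?H = "attach_paths k G v (p + q) 0" and ?H' = "attach_paths k G v p q"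
  let ?v = "Old v" and ?u = "New True p 0"
  have H: "uniform_hypergraph k ?H" and H': "uniform_hypergraph k ?H'"
    using attach_paths_uniform[OF k_ge2 G v] by auto
  have ind: "indecomposable ?H" by (rule attach_paths_indecomposable[OF k_ge2 conn v])
  have V: "?v \<in> verts ?H" "?u \<in> verts ?H"
    using v pq k_ge2 by (auto simp: attach_paths_def)
  have vN: "verts (move_edges r w M ?H) \<noteq> {}" for r w M
    using V(1) by (auto simp: move_edges_def simp del: mem_verts_attach_paths)
  have edge_cases: thesis
    if "e \<in> edges ?H" "\<And>e'. e' \<in> edges G \<Longrightarrow> e = Old ` e' \<Longrightarrow> thesis"
      "\<And>i. 1 \<le> i \<Longrightarrow> i \<le> p + q \<Longrightarrow> e = path_edge k v True i \<Longrightarrow> thesis" for e thesis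
    using that by (auto simp: attach_paths_def)
  obtain x where x: "maximiser ?H x" using maximiser_exists[OF H] V by blast
  show ?thesis
  proof (cases "x ?u \<le> x ?v")
    case True
    let ?f = "path_edge k v True (p + 1)"
    have M: "{?f} \<subseteq> edges ?H" "e \<in> {?f} \<Longrightarrow> ?u \<in> e \<and> ?v \<notin> e" for e
      using pq by (auto simp: mem_path_edge path_edge_in_attach_paths)
    have "swap_vertex ?u ?v ?f \<notin> edges ?H"
    proof
      have mem: "New True (p + 1) 0 \<in> swap_vertex ?u ?v ?f" "?v \<in> swap_vertex ?u ?v ?f"
        using k_ge2 by (auto simp: swap_vertex_def mem_path_edge)
      assume "swap_vertex ?u ?v ?f \<in> edges ?H"
      thus False using mem pq by (elim edge_cases) (auto simp: mem_path_edge)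
    qed
    hence "swap_vertex ?u ?v ` {?f} \<inter> (edges ?H - {?f}) = {}" by auto
    hence "radius ?H < radius (move_edges ?u ?v {?f} ?H)"
      using M by (intro radius_less_move_edges[OF H ind x V(2,1) True]) auto
    also have "\<dots> \<le> radius ?H'"
    proof (rule move_path_to_root_iso[OF k_ge2 pq])
      fix f assume "bij_betw f (verts ?H') (verts (move_edges ?u ?v {?f} ?H))"
        "edges (move_edges ?u ?v {?f} ?H) = image f ` edges ?H'"
      thus ?thesis using M by (intro radius_le_of_iso[OF H' move_edges_uniform[OF H V(1)] vN])
    qed
    finally show ?thesis .
  next
    case False
    let ?M = "{Old ` e |e. e \<in> edges G \<and> v \<in> e}"
    have M: "?M \<subseteq> edges ?H" "e \<in> ?M \<Longrightarrow> ?v \<in> e \<and> ?u \<notin> e" for e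
      by (auto simp: attach_paths_def)
    have "swap_vertex ?v ?u (Old ` e) \<notin> edges ?H" if e: "e \<in> edges G" "v \<in> e" for e
    proof
      have "card e \<noteq> 1" using uniformD(4)[OF G e(1)] k_ge2 by simp
      then obtain z where z: "z \<in> e" "z \<noteq> v" using e(2) by (metis is_singletonI' is_singleton_altdef empty_iff)
      have mem: "?u \<in> swap_vertex ?v ?u (Old ` e)" "Old z \<in> swap_vertex ?v ?u (Old ` e)"
        using z by (auto simp: swap_vertex_def)
      assume "swap_vertex ?v ?u (Old ` e) \<in> edges ?H"
      thus False using mem z by (elim edge_cases) (auto simp: mem_path_edge)
    qed
    hence "swap_vertex ?v ?u ` ?M \<inter> (edges ?H - ?M) = {}" by auto
    moreover have "?M \<noteq> {}" using exists_edge_at[OF k_ge2 G conn ne v] by blast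
    ultimately have "radius ?H < radius (move_edges ?v ?u ?M ?H)"
      using M False by (intro radius_less_move_edges[OF H ind x V]) auto
    also have "\<dots> \<le> radius ?H'"
    proof (rule move_root_along_path_iso[OF k_ge2 v pq])
      fix f assume "bij_betw f (verts ?H') (verts (move_edges ?v ?u ?M ?H))"
        "edges (move_edges ?v ?u ?M ?H) = image f ` edges ?H'"
      thus ?thesis using M by (intro radius_le_of_iso[OF H' move_edges_uniform[OF H V(2)] vN])
    qed
    finally show ?thesis .
  qed
qed

end

section \<open>The three tensors\<close>

lemma sum_lists_prod_list:
  fixes x :: "'v \<Rightarrow> complex"
  assumes "finite A"
  shows "(\<Sum>js | set js \<subseteq> A \<and> length js = n. \<Prod>j\<leftarrow>js. x j) = (\<Sum>j\<in>A. x j) ^ n"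
proof (induction n)
  case 0
  have "{js. set js \<subseteq> A \<and> length js = 0} = {[]}" by auto
  thus ?case by simp
next
  case (Suc n)
  have "(\<Sum>js | set js \<subseteq> A \<and> length js = Suc n. \<Prod>j\<leftarrow>js. x j)
      = (\<Sum>(js, j)\<in>{js. set js \<subseteq> A \<and> length js = n} \<times> A. x j * (\<Prod>j\<leftarrow>js. x j))"
    unfolding lists_length_Suc_eq
    by (subst sum.reindex) (auto simp: inj_on_def case_prod_unfold)
  also have "\<dots> = (\<Sum>js | set js \<subseteq> A \<and> length js = n. (\<Sum>j\<in>A. x j) * (\<Prod>j\<leftarrow>js. x j))"
    by (simp add: sum.cartesian_product[symmetric] sum_distrib_right)
  also have "\<dots> = (\<Sum>j\<in>A. x j) * (\<Sum>j\<in>A. x j) ^ n"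
    by (simp add: sum_distrib_left[symmetric] Suc.IH)
  finally show ?case by simp
qed

text \<open>
  Since \<open>e\<close> has \<open>k\<close> elements, the index lists that complete \<open>i\<close> to \<open>e\<close> are the \<open>(k - 1)!\<close>
  enumerations of \<open>e - {i}\<close>, which cancels the factor in the entries of the adjacency tensor.
\<close>

lemma lists_completing_edge:
  assumes e: "finite e" "card e = k" "i \<in> e" "e \<subseteq> V"
  shows "{js. set js \<subseteq> V \<and> length js = k - 1 \<and> insert i (set js) = e} = permutations_of_set (e - {i})"
proof (rule set_eqI)
  fix js
  have cd: "card (e - {i}) = k - 1"
    using card_Diff_singleton[OF e(3)] unfolding e(2) .
  have "e \<noteq> {}" using e(3) by blast
  hence k: "0 < k" using card_gt_0_iff[of e] e(1) unfolding e(2) by blast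
  have "distinct js \<and> set js = e - {i}" if js: "length js = k - 1" "insert i (set js) = e"
  proof -
    have "i \<notin> set js"
    proof
      assume "i \<in> set js"
      hence "set js = e" using js(2) by (simp add: insert_absorb)
      hence "k \<le> k - 1" using card_length[of js] unfolding js(1) e(2)[symmetric] by simp
      thus False using k by linarith
    qed
    hence s: "set js = e - {i}" using js(2) by (metis Diff_insert_absorb)
    hence "card (set js) = length js" using cd js(1) by metis
    thus ?thesis using s card_distinct by metis
  qed
  moreover have "length js = k - 1 \<and> insert i (set js) = e \<and> set js \<subseteq> V"
    if js: "distinct js" "set js = e - {i}"
  proof (intro conjI)
    show "length js = k - 1" using distinct_card[OF js(1)] unfolding js(2) cd by simp
    show "insert i (set js) = e" "set js \<subseteq> V" unfolding js(2) using e(3,4) by auto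
  qed
  ultimately show "js \<in> {js. set js \<subseteq> V \<and> length js = k - 1 \<and> insert i (set js) = e}
      \<longleftrightarrow> js \<in> permutations_of_set (e - {i})"
    unfolding permutations_of_set_def mem_Collect_eq by (intro iffI; elim conjE) metis+
qed

lemma tensor_apply_adjacency:
  assumes H: "uniform_hypergraph k H"
  shows "tensor_apply k (verts H) (adjacency_tensor k H) x i
    = (\<Sum>e | e \<in> edges H \<and> i \<in> e. \<Prod>j\<in>e - {i}. x j)"
proof -
  note u = uniformD[OF H]
  let ?L = "{js. set js \<subseteq> verts H \<and> length js = k - 1}"
  let ?E = "{e. e \<in> edges H \<and> i \<in> e}"
  let ?t = "\<lambda>js. (\<Prod>j\<leftarrow>js. x j) / fact (k - 1)"
  have fL: "finite ?L" using u(1) by (simp add: finite_lists_length_eq)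
  have "tensor_apply k (verts H) (adjacency_tensor k H) x i
      = (\<Sum>js\<in>?L. \<Sum>e | e \<in> ?E \<and> insert i (set js) = e. ?t js)"
    unfolding tensor_apply_def
  proof (rule sum.cong[OF refl])
    fix js
    have "{e. e \<in> ?E \<and> insert i (set js) = e}
        = (if insert i (set js) \<in> edges H then {insert i (set js)} else {})" by auto
    thus "complex_of_real (adjacency_tensor k H (i # js)) * (\<Prod>j\<leftarrow>js. x j)
        = (\<Sum>e | e \<in> ?E \<and> insert i (set js) = e. ?t js)"
      by (simp add: adjacency_tensor_def)
  qed
  also have "\<dots> = (\<Sum>e\<in>?E. \<Sum>js | js \<in> ?L \<and> insert i (set js) = e. ?t js)"
    using fL u(2) by (intro sum.swap_restrict) auto
  also have "\<dots> = (\<Sum>e\<in>?E. \<Prod>j\<in>e - {i}. x j)"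
  proof (rule sum.cong[OF refl])
    fix e assume e: "e \<in> ?E"
    hence e': "finite e" "card e = k" "i \<in> e" "e \<subseteq> verts H" using u by auto
    have "(\<Sum>js | js \<in> ?L \<and> insert i (set js) = e. ?t js) = (\<Sum>js\<in>permutations_of_set (e - {i}). ?t js)"
      using lists_completing_edge[OF e'] by (simp add: conj_assoc)
    also have "\<dots> = (\<Sum>js\<in>permutations_of_set (e - {i}). (\<Prod>j\<in>e - {i}. x j) / fact (k - 1))"
      by (intro sum.cong refl)
         (auto simp: permutations_of_set_def prod.distinct_set_conv_list[symmetric])
    also have "\<dots> = (\<Prod>j\<in>e - {i}. x j)" using e' by simp
    finally show "(\<Sum>js | js \<in> ?L \<and> insert i (set js) = e. ?t js) = (\<Prod>j\<in>e - {i}. x j)" .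
  qed
  finally show ?thesis .
qed

lemma tensor_apply_degree:
  assumes H: "uniform_hypergraph k H" and k: "2 \<le> k" and i: "i \<in> verts H"
  shows "tensor_apply k (verts H) (degree_tensor k H) x i
    = (\<Sum>e | e \<in> edges H \<and> i \<in> e. x i ^ (k - 1))"
proof -
  let ?L = "{js. set js \<subseteq> verts H \<and> length js = k - 1}"
  let ?r = "replicate (k - 1) i"
  have fL: "finite ?L" using uniformD(1)[OF H] by (simp add: finite_lists_length_eq)
  have r: "replicate k i = i # ?r" using k by (cases k) auto
  have "tensor_apply k (verts H) (degree_tensor k H) x i
      = (\<Sum>js\<in>?L. if js = ?r then of_nat (vertex_degree H i) * x i ^ (k - 1) else 0)"
    unfolding tensor_apply_def degree_tensor_def list.sel r by (intro sum.cong) auto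
  also have "\<dots> = of_nat (vertex_degree H i) * x i ^ (k - 1)"
    using i fL by (subst sum.delta) auto
  also have "\<dots> = (\<Sum>e | e \<in> edges H \<and> i \<in> e. x i ^ (k - 1))"
    by (simp add: vertex_degree_def)
  finally show ?thesis .
qed

lemma tensor_apply_signless_laplacian:
  assumes "uniform_hypergraph k H" "2 \<le> k" "i \<in> verts H"
  shows "tensor_apply k (verts H) (signless_laplacian_tensor k H) x i
    = (\<Sum>e | e \<in> edges H \<and> i \<in> e. x i ^ (k - 1) + (\<Prod>j\<in>e - {i}. x j))"
proof -
  have "tensor_apply k (verts H) (signless_laplacian_tensor k H) x i
      = tensor_apply k (verts H) (degree_tensor k H) x i
        + tensor_apply k (verts H) (adjacency_tensor k H) x i"
    unfolding tensor_apply_def signless_laplacian_tensor_def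
    by (simp add: distrib_right sum.distrib)
  thus ?thesis
    unfolding tensor_apply_degree[OF assms] tensor_apply_adjacency[OF assms(1)]
    by (simp add: sum.distrib)
qed

lemma tensor_apply_incidence_Q:
  assumes H: "uniform_hypergraph k H"
  shows "tensor_apply k (verts H) (incidence_Q_tensor H) x i
    = (\<Sum>e | e \<in> edges H \<and> i \<in> e. (\<Sum>j\<in>e. x j) ^ (k - 1))"
proof -
  note u = uniformD[OF H]
  let ?L = "{js. set js \<subseteq> verts H \<and> length js = k - 1}"
  let ?E = "{e. e \<in> edges H \<and> i \<in> e}"
  have fL: "finite ?L" using u(1) by (simp add: finite_lists_length_eq)
  have "tensor_apply k (verts H) (incidence_Q_tensor H) x i
      = (\<Sum>js\<in>?L. \<Sum>e | e \<in> ?E \<and> set js \<subseteq> e. \<Prod>j\<leftarrow>js. x j)"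
    unfolding tensor_apply_def incidence_Q_tensor_def by (simp add: conj_assoc)
  also have "\<dots> = (\<Sum>e\<in>?E. \<Sum>js | js \<in> ?L \<and> set js \<subseteq> e. \<Prod>j\<leftarrow>js. x j)"
    using fL u(2) by (intro sum.swap_restrict) auto
  also have "\<dots> = (\<Sum>e\<in>?E. (\<Sum>j\<in>e. x j) ^ (k - 1))"
  proof (rule sum.cong[OF refl])
    fix e assume e: "e \<in> ?E"
    hence "{js. js \<in> ?L \<and> set js \<subseteq> e} = {js. set js \<subseteq> e \<and> length js = k - 1}" using u(3) by blast
    thus "(\<Sum>js | js \<in> ?L \<and> set js \<subseteq> e. \<Prod>j\<leftarrow>js. x j) = (\<Sum>j\<in>e. x j) ^ (k - 1)"
      using sum_lists_prod_list[of e x "k - 1"] e u(5) by simp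
  qed
  finally show ?thesis .
qed

lemma rho_eq_radius:
  assumes k: "2 \<le> k" and H: "uniform_hypergraph k H" and ne: "verts H \<noteq> {}"
  shows "rho_A k H = edge_form.radius k 0 1 0 H"
    and "rho_Q k H = edge_form.radius k 1 1 0 H"
    and "rho_Qstar k H = edge_form.radius k 0 0 1 H"
proof -
  interpret A: edge_form k 0 1 0 by standard (use k in auto)
  interpret Q: edge_form k 1 1 0 by standard (use k in auto)
  interpret S: edge_form k 0 0 1 by standard (use k in auto)
  show "rho_A k H = A.radius H"
    unfolding rho_A_def using tensor_apply_adjacency[OF H]
    by (intro A.tensor_spectral_radius_eq_radius[OF H ne]) (simp add: A.gradient_def A.psi_def)
  show "rho_Q k H = Q.radius H"
    unfolding rho_Q_def using tensor_apply_signless_laplacian[OF H k]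
    by (intro Q.tensor_spectral_radius_eq_radius[OF H ne]) (simp add: Q.gradient_def Q.psi_def)
  show "rho_Qstar k H = S.radius H"
    unfolding rho_Qstar_def using tensor_apply_incidence_Q[OF H]
    by (intro S.tensor_spectral_radius_eq_radius[OF H ne]) (simp add: S.gradient_def S.psi_def)
qed

theorem theorem24:
  fixes G :: "'a hypergraph" and v :: 'a and k p q :: nat
  assumes "k \<ge> 2"
    and "uniform_hypergraph k G"
    and "linear_hypergraph G"
    and "connected_hypergraph G"
    and "edges G \<noteq> {}"
    and "v \<in> verts G"
    and "p \<noteq> 0" and "q \<noteq> 0"
  shows "rho_A k (attach_paths k G v p q) > rho_A k (attach_paths k G v (p + q) 0) \<and>
         rho_Q k (attach_paths k G v p q) > rho_Q k (attach_paths k G v (p + q) 0) \<and>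
         rho_Qstar k (attach_paths k G v p q) > rho_Qstar k (attach_paths k G v (p + q) 0)"
proof -
  have u: "uniform_hypergraph k (attach_paths k G v m n)" for m n
    using attach_paths_uniform[OF assms(1,2,6)] .
  have ne: "verts (attach_paths k G v m n) \<noteq> {}" for m n
    using assms(6) by (auto simp: attach_paths_def)
  have less: "edge_form.radius k a b c (attach_paths k G v (p + q) 0)
      < edge_form.radius k a b c (attach_paths k G v p q)" if "edge_form k a b c" for a b c
    using edge_form.radius_attach_paths_less[OF that assms(2,4-8)] .
  show ?thesis
    unfolding rho_eq_radius[OF assms(1) u ne]
    by (intro conjI less edge_form.intro) (use assms(1) in auto)
qed

end
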